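(* Let $H$ be a Krull monoid that is not half-factorial, whose class group $G$ is finite cyclic of prime order. Let $d$ be an integer with $d \ge (2|G|^2)^{1/3}$. Then $H$ is $d$-congruence half-factorial if and only if at most two non-zero classes, say $g_1,g_2$, contain prime divisors, and these two classes satisfy: there are positive integers $c_1,c_2$ such that $c_2 g_1 + c_1 g_2 = 0$ and $d c_1 c_2$ divides $|G| - c_1 - c_2$.
   Context: A monoid is a commutative cancellative semigroup with identity. For a monoid $H$ and $a\in H$, $\mathsf L(a)$ is the set of all $\ell\ge 0$ such that $a$ is a product of $\ell$ irreducible elements (atoms) of $H$ (for units, $\mathsf L(a)=\{0\}$). $H$ is half-factorial if $|\mathsf L(a)|=1$ for all $a\in H$. For $d\in\mathbb N$, $H$ is $d$-congruence half-factorial if for every $a\in H$ and all $\ell,\ell'\in\mathsf L(a)$ one has $\ell\equiv\ell'\pmod d$. $H$ is a Krull monoid if there is a homomorphism $\varphi:H\to\mathcal F(P)$ into a free abelian monoid $\mathcal F(P)$ with basis $P$ such that $a\mid b$ in $H$ iff $\varphi(a)\mid\varphi(b)$ in $\mathcal F(P)$; it then has a divisor theory, i.e. such a $\varphi$ with the additional property that each $p\in P$ is the gcd of finitely many elements of $\varphi(H)$, unique up to isomorphism. The class group of $H$ is the quotient group $\mathsf q(\mathcal F(P))/\mathsf q(\varphi(H))$ (quotient groups of the monoids), for a divisor theory $\varphi$; the elements of $P$ are the prime divisors, and a class contains prime divisors if it contains some $p\in P$. *)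

theory Defs
  imports
    Complex_Main
    "HOL-Algebra.Divisibility"
    "HOL-Algebra.Elementary_Groups"
    "HOL-Algebra.Free_Abelian_Groups"
    "HOL-Library.Multiset"
    "HOL-Number_Theory.Cong"
begin

text \<open>Monoids are commutative and cancellative: the library locale \<^locale>\<open>comm_monoid_cancel\<close>.\<close>

text \<open>For units the value is a convention: the empty product yields only the identity.\<close>

definition lengths :: "('a, 'm) monoid_scheme \<Rightarrow> 'a \<Rightarrow> nat set" where
  "lengths H a =
     (if a \<in> Units H then {0}
      else {length fs | fs. set fs \<subseteq> carrier H \<and> factors H fs a})"

definition half_factorial :: "('a, 'm) monoid_scheme \<Rightarrow> bool" where
  "half_factorial H \<longleftrightarrow> (\<forall>a\<in>carrier H. card (lengths H a) = 1)"

definition congruence_half_factorial :: "nat \<Rightarrow> ('a, 'm) monoid_scheme \<Rightarrow> bool" where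
  "congruence_half_factorial d H \<longleftrightarrow>
     (\<forall>a\<in>carrier H. \<forall>l\<in>lengths H a. \<forall>l'\<in>lengths H a. [l = l'] (mod d))"

definition free_abelian_monoid :: "'p set \<Rightarrow> 'p multiset monoid" where
  "free_abelian_monoid P =
     \<lparr>carrier = {M. set_mset M \<subseteq> P}, monoid.mult = (+), one = {#}\<rparr>"

text \<open>Preservation of the identity is automatic, because the target is cancellative.\<close>

definition divisor_homomorphism ::
    "('a, 'm) monoid_scheme \<Rightarrow> 'p set \<Rightarrow> ('a \<Rightarrow> 'p multiset) \<Rightarrow> bool" where
  "divisor_homomorphism H P \<phi> \<longleftrightarrow>
     \<phi> \<in> hom H (free_abelian_monoid P) \<and>
     (\<forall>a\<in>carrier H. \<forall>b\<in>carrier H.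
        a divides\<^bsub>H\<^esub> b \<longleftrightarrow> \<phi> a divides\<^bsub>free_abelian_monoid P\<^esub> \<phi> b)"

text \<open>The greatest element of the lower bounds in the divisibility order is the gcd.\<close>

definition divisor_theory ::
    "('a, 'm) monoid_scheme \<Rightarrow> 'p set \<Rightarrow> ('a \<Rightarrow> 'p multiset) \<Rightarrow> bool" where
  "divisor_theory H P \<phi> \<longleftrightarrow>
     divisor_homomorphism H P \<phi> \<and>
     (\<forall>p\<in>P. \<exists>X. finite X \<and> X \<subseteq> carrier H \<and>
        greatest (division_rel (free_abelian_monoid P)) {#p#}
          (Lower (division_rel (free_abelian_monoid P)) (\<phi> ` X)))"

text \<open>
  An existential quantifier cannot range over types, so the basis is taken inside the type
  \<^typ>\<open>'a set\<close>. This loses no generality: a Krull monoid has a divisor theory, and the prime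
  divisors \<open>p\<close> of a divisor theory \<open>\<phi>\<close> are determined by the sets
  \<open>{h. p divides \<phi> h}\<close>; see \<open>divisor_theory_imp_krull_monoid\<close> below.
\<close>

definition krull_monoid :: "('a, 'm) monoid_scheme \<Rightarrow> bool" where
  "krull_monoid H \<longleftrightarrow> comm_monoid_cancel H \<and>
     (\<exists>(P :: 'a set set) \<phi>. divisor_homomorphism H P \<phi>)"

text \<open>
  The quotient group of the free abelian monoid on \<open>P\<close> is the free abelian group on \<open>P\<close>, which
  the library writes additively on finitely supported functions; \<open>divisor_embedding\<close> is the
  canonical embedding of the former into the latter.
\<close>

definition divisor_embedding :: "'p multiset \<Rightarrow> 'p \<Rightarrow>\<^sub>0 int" where
  "divisor_embedding M = (\<Sum>p\<in>#M. frag_of p)"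

definition principal_divisors ::
    "('a, 'm) monoid_scheme \<Rightarrow> ('a \<Rightarrow> 'p multiset) \<Rightarrow> ('p \<Rightarrow>\<^sub>0 int) set" where
  "principal_divisors H \<phi> =
     {divisor_embedding (\<phi> a) - divisor_embedding (\<phi> b) | a b. a \<in> carrier H \<and> b \<in> carrier H}"

text \<open>
  The class group carries the multiplicative notation of \<open>HOL-Algebra\<close>; its elements are cosets,
  that is, sets of divisors.
\<close>

definition class_group ::
    "('a, 'm) monoid_scheme \<Rightarrow> 'p set \<Rightarrow> ('a \<Rightarrow> 'p multiset) \<Rightarrow> ('p \<Rightarrow>\<^sub>0 int) set monoid" where
  "class_group H P \<phi> = free_Abelian_group P Mod principal_divisors H \<phi>"

definition nonzero_prime_classes ::
    "('a, 'm) monoid_scheme \<Rightarrow> 'p set \<Rightarrow> ('a \<Rightarrow> 'p multiset) \<Rightarrow> ('p \<Rightarrow>\<^sub>0 int) set set" where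
  "nonzero_prime_classes H P \<phi> =
     {g \<in> carrier (class_group H P \<phi>).
        g \<noteq> \<one>\<^bsub>class_group H P \<phi>\<^esub> \<and> (\<exists>p\<in>P. frag_of p \<in> g)}"

lemma divides_free_abelian_monoid:
  assumes "set_mset B \<subseteq> P"
  shows "A divides\<^bsub>free_abelian_monoid P\<^esub> B \<longleftrightarrow> A \<subseteq># B"
proof
  assume "A divides\<^bsub>free_abelian_monoid P\<^esub> B"
  then show "A \<subseteq># B" by (auto simp: factor_def free_abelian_monoid_def)
next
  assume AB: "A \<subseteq># B"
  then have "B = A + (B - A)" by simp
  moreover have "set_mset (B - A) \<subseteq> P" using assms by (meson in_diffD subset_iff)
  ultimately show "A divides\<^bsub>free_abelian_monoid P\<^esub> B"
    by (auto simp: factor_def free_abelian_monoid_def)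
qed

lemma divisor_theory_imp_krull_monoid:
  assumes H: "comm_monoid_cancel H" and dt: "divisor_theory H P \<phi>"
  shows "krull_monoid H"
proof -
  define F where "F = free_abelian_monoid P"
  define \<iota> where "\<iota> p = {h \<in> carrier H. p \<in># \<phi> h}" for p
  define \<psi> where "\<psi> h = image_mset \<iota> (\<phi> h)" for h
  have hom: "\<phi> \<in> hom H F"
    and dv: "\<And>a b. a \<in> carrier H \<Longrightarrow> b \<in> carrier H \<Longrightarrow> a divides\<^bsub>H\<^esub> b \<longleftrightarrow> \<phi> a divides\<^bsub>F\<^esub> \<phi> b"
    using dt by (auto simp: divisor_theory_def divisor_homomorphism_def F_def)
  have inP: "set_mset (\<phi> a) \<subseteq> P" if "a \<in> carrier H" for a
    using hom that by (auto simp: hom_def F_def free_abelian_monoid_def Pi_iff)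
  have sub: "\<iota> p \<subseteq> \<iota> q \<Longrightarrow> p = q" if p: "p \<in> P" and q: "q \<in> P" for p q
  proof (rule ccontr)
    assume s: "\<iota> p \<subseteq> \<iota> q" and ne: "p \<noteq> q"
    obtain X where X: "X \<subseteq> carrier H"
      and gr: "greatest (division_rel F) {#p#} (Lower (division_rel F) (\<phi> ` X))"
      using dt p unfolding divisor_theory_def F_def by blast
    have FX: "\<phi> ` X \<subseteq> carrier F" using inP X by (auto simp: F_def free_abelian_monoid_def)
    have "p \<in># \<phi> x" if "x \<in> X" for x
    proof -
      have "{#p#} divides\<^bsub>F\<^esub> \<phi> x"
        using gr that FX by (auto simp: greatest_def Lower_def)
      then have "{#p#} \<subseteq># \<phi> x"
        using divides_free_abelian_monoid[OF inP, of x "{#p#}"] that X F_def by auto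
      then show ?thesis by simp
    qed
    then have qX: "q \<in># \<phi> x" if "x \<in> X" for x
      using s that X by (auto simp: \<iota>_def)
    have "{#q#} divides\<^bsub>F\<^esub> \<phi> x" if "x \<in> X" for x
      using divides_free_abelian_monoid[OF inP, of x "{#q#}"] qX[OF that] that X F_def by auto
    then have "{#q#} \<in> Lower (division_rel F) (\<phi> ` X)"
      using q by (auto simp: Lower_def F_def free_abelian_monoid_def)
    then have "{#q#} divides\<^bsub>F\<^esub> {#p#}" using gr by (auto simp: greatest_def)
    then have "{#q#} \<subseteq># {#p#}"
      using divides_free_abelian_monoid[of "{#p#}" P "{#q#}"] p F_def by auto
    then show False using ne by simp
  qed
  then have inj: "inj_on \<iota> P" by (auto simp: inj_on_def)
  have inv_psi: "image_mset (inv_into P \<iota>) (\<psi> a) = \<phi> a" if "a \<in> carrier H" for a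
  proof -
    have "image_mset (inv_into P \<iota>) (\<psi> a) = image_mset (\<lambda>p. p) (\<phi> a)"
      unfolding \<psi>_def image_mset.compositionality
      using inP[OF that] inj by (intro image_mset_cong) (auto simp: subset_iff)
    then show ?thesis by simp
  qed
  have psiP: "set_mset (\<psi> a) \<subseteq> \<iota> ` P" if "a \<in> carrier H" for a
    using inP[OF that] by (auto simp: \<psi>_def)
  have "divisor_homomorphism H (\<iota> ` P) \<psi>"
    unfolding divisor_homomorphism_def
  proof (intro conjI ballI)
    show "\<psi> \<in> hom H (free_abelian_monoid (\<iota> ` P))"
      using hom psiP by (auto simp: hom_def F_def free_abelian_monoid_def \<psi>_def)
  next
    fix a b assume a: "a \<in> carrier H" and b: "b \<in> carrier H"
    have "\<phi> a \<subseteq># \<phi> b \<longleftrightarrow> \<psi> a \<subseteq># \<psi> b"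
      using inv_psi[OF a] inv_psi[OF b] by (metis \<psi>_def image_mset_subseteq_mono)
    then show "a divides\<^bsub>H\<^esub> b \<longleftrightarrow> \<psi> a divides\<^bsub>free_abelian_monoid (\<iota> ` P)\<^esub> \<psi> b"
      using dv[OF a b] divides_free_abelian_monoid[OF inP[OF b]]
        divides_free_abelian_monoid[OF psiP[OF b]] F_def by auto
  qed
  then show ?thesis using H unfolding krull_monoid_def by blast
qed

end

theory Submission
  imports Defs "HOL-Algebra.Multiplicative_Group"
begin

text \<open>
  Write \<open>n\<close> for the order of the class group. Lengths in \<open>H\<close> are lengths of factorizations of zero-sum
  sequences over the classes containing prime divisors. If an atom \<open>A\<close> involves only non-principal
  prime divisors, then \<open>A\<^sup>n\<close> is also a product of \<open>|A|\<close> atoms of the form \<open>p\<^sup>n\<close>; so \<open>d\<close>-congruence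
  half-factoriality forces \<open>|A| \<equiv> n\<close> modulo \<open>d\<close>, and conversely this suffices if \<open>d\<close> is prime to \<open>n\<close>.

  For distinct non-zero classes \<open>g\<close> and \<open>h = a g\<close> with \<open>1 < a < n\<close>, write \<open>n = q a + r\<close> and \<open>c = \<lceil>a / r\<rceil>\<close>. The
  atoms \<open>g\<^sup>n\<^sup>-\<^sup>a h\<close> and \<open>g\<^sup>r\<^sup>c\<^sup>-\<^sup>a h\<^sup>q\<^sup>c\<^sup>+\<^sup>1\<close> have length congruent to \<open>n\<close> only if \<open>d r\<close> divides \<open>a - 1\<close>, which is
  the claim for \<open>c\<^sub>1 = q\<close> and \<open>c\<^sub>2 = r\<close>. In particular \<open>d c\<^sub>1 c\<^sub>2 < n\<close>. Given three classes, the three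
  relations of this kind combine to \<open>(X + Y) h = 0\<close> with \<open>X, Y > 0\<close> and \<open>d\<^sup>3 X Y < n\<^sup>3\<close>. But then
  \<open>X + Y \<ge> n\<close>, so \<open>X Y \<ge> n - 1\<close>, which is incompatible with \<open>d\<^sup>3 \<ge> 2 n\<^sup>2\<close>.
\<close>

section \<open>Minimal zero-sum multisets of residues modulo \<open>n\<close>\<close>

text \<open>These are the atoms of the monoid of zero-sum sequences over Z/n. Residues are
  represented by natural numbers, so a vanishing sum becomes divisibility of an ordinary sum by
  \<open>n\<close>.\<close>

definition min_zero_sum :: "nat \<Rightarrow> nat multiset \<Rightarrow> bool" where
  "min_zero_sum n B \<longleftrightarrow> B \<noteq> {#} \<and> n dvd \<Sum>\<^sub># B \<and>
     (\<forall>C. C \<subseteq># B \<longrightarrow> C \<noteq> {#} \<longrightarrow> n dvd \<Sum>\<^sub># C \<longrightarrow> C = B)"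

lemma subseteq_two_replicate_mset:
  assumes "g \<noteq> h" "C \<subseteq># replicate_mset x g + replicate_mset y h"
  shows "C = replicate_mset (count C g) g + replicate_mset (count C h) h"
proof (rule multiset_eqI)
  fix z
  have "count C z \<le> count (replicate_mset x g + replicate_mset y h) z"
    using assms(2) by (rule mset_subset_eq_count)
  with assms(1) show "count C z = count (replicate_mset (count C g) g + replicate_mset (count C h) h) z"
    by (auto split: if_splits)
qed

text \<open>For distinct \<open>g\<close> and \<open>h\<close> a submultiset is determined by its
  two multiplicities, so being an atom becomes minimality of a solution of a linear congruence in
  two unknowns.\<close>

lemma min_zero_sum_two:
  assumes "g \<noteq> h"
  shows "min_zero_sum n (replicate_mset x g + replicate_mset y h) \<longleftrightarrow>
    0 < x + y \<and> n dvd x * g + y * h \<and>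
    (\<forall>x' y'. x' \<le> x \<longrightarrow> y' \<le> y \<longrightarrow> 0 < x' + y' \<longrightarrow> n dvd x' * g + y' * h \<longrightarrow> x' = x \<and> y' = y)"
    (is "?L \<longleftrightarrow> ?R")
proof
  assume L: ?L
  show ?R
  proof (intro conjI allI impI)
    fix x' y' assume a: "x' \<le> x" "y' \<le> y" "0 < x' + y'" "n dvd x' * g + y' * h"
    let ?C = "replicate_mset x' g + replicate_mset y' h"
    have "?C \<subseteq># replicate_mset x g + replicate_mset y h"
      using a by (intro subset_mset.add_mono) (auto simp: subseteq_mset_def)
    moreover have "?C \<noteq> {#}" "n dvd \<Sum>\<^sub># ?C" using a by (auto simp: replicate_mset_eq_empty_iff)
    ultimately have "?C = replicate_mset x g + replicate_mset y h"
      using L unfolding min_zero_sum_def by blast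
    then have "count ?C z = count (replicate_mset x g + replicate_mset y h) z" for z by simp
    from this[of g] this[of h] assms show "x' = x" "y' = y" by auto
  qed (use L in \<open>auto simp: min_zero_sum_def replicate_mset_eq_empty_iff\<close>)
next
  assume R: ?R
  have "C = replicate_mset x g + replicate_mset y h"
    if C: "C \<subseteq># replicate_mset x g + replicate_mset y h" "C \<noteq> {#}" "n dvd \<Sum>\<^sub># C" for C
  proof -
    note eq = subseteq_two_replicate_mset[OF assms C(1)]
    have "count C g \<le> x" "count C h \<le> y"
      using mset_subset_eq_count[OF C(1), of g] mset_subset_eq_count[OF C(1), of h] assms by auto
    moreover have "0 < count C g + count C h"
    proof (rule ccontr)
      assume "\<not> 0 < count C g + count C h"
      then have "count C g = 0" "count C h = 0" by linarith+
      then have "C = {#}" by (subst eq) simp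
      then show False using C(2) by simp
    qed
    moreover have "n dvd count C g * g + count C h * h"
      using C(3) by (subst (asm) eq) simp
    ultimately have "count C g = x \<and> count C h = y"
      by (rule R[THEN conjunct2, THEN conjunct2, rule_format])
    then show ?thesis by (subst eq) simp
  qed
  then show ?L using R by (auto simp: min_zero_sum_def replicate_mset_eq_empty_iff)
qed

section \<open>The relation forced on two distinct non-zero classes\<close>

text \<open>Write \<open>x + a * y = n * s\<close> and \<open>y = s * q + t\<close>; then
  \<open>x = s * r - t * a\<close>. As \<open>x < r\<close>, the integer \<open>t\<close> is
  positive, so \<open>s * r \<ge> a\<close>, and hence \<open>s \<ge> c\<close> because
  \<open>(c - 1) * r < a\<close>. Thus \<open>y \<ge> q * c + 1\<close>, and the upper bound on
  \<open>y\<close> leaves only \<open>s = c\<close> and \<open>t = 1\<close>.\<close>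

lemma euclid_min_zero_sum:
  fixes a n q r x y \<rho> c :: nat
  assumes n: "n = q * a + r" and r: "0 < r" "r < a" and q: "0 < q"
    and c: "c * r = a + \<rho>" "\<rho> < r"
    and xy: "x \<le> \<rho>" "y \<le> q * c + 1" "0 < x + y" "n dvd x + a * y"
  shows "x = \<rho>" "y = q * c + 1"
proof -
  obtain s where s: "x + a * y = n * s" using xy(4) by (elim dvdE)
  have s0: "s > 0" using s xy(3) r by (cases s) auto
  define t where "t = int y - int s * int q"
  have y: "int y = int s * int q + t" by (simp add: t_def)
  have "int x + int a * int y = int n * int s" using s by (metis of_nat_add of_nat_mult)
  then have x: "int x = int s * int r - t * int a"
    unfolding y n by (simp add: algebra_simps)
  have xr: "int x < int r" using xy c by simp
  have s1: "int s \<ge> 1" using s0 by simp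
  have "int r \<le> int s * int r" using s1 mult_right_mono[of 1 "int s" "int r"] by simp
  then have "t * int a > 0" using x xr by linarith
  then have t: "t \<ge> 1" using r by (simp add: zero_less_mult_iff)
  have "t * int a \<ge> int a" using t mult_right_mono[of 1 t "int a"] by simp
  then have "int a \<le> int s * int r" using x by linarith
  have sc: "s \<ge> c"
  proof (rule ccontr)
    assume "\<not> s \<ge> c"
    then have "int s + 1 \<le> int c" by simp
    then have "(int s + 1) * int r \<le> int c * int r" by (intro mult_right_mono) auto
    also have "int c * int r = int a + int \<rho>" using c by (metis of_nat_add of_nat_mult)
    finally have "int s * int r + int r \<le> int a + int \<rho>" by (simp add: algebra_simps)
    then show False using \<open>int a \<le> int s * int r\<close> c by linarith
  qed
  have "int y \<le> int q * int c + 1" using xy(2) by (metis of_nat_1 of_nat_add of_nat_le_iff of_nat_mult)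
  moreover have "int s * int q \<ge> int c * int q" using sc by (intro mult_right_mono) auto
  ultimately have "t = 1" and "int s * int q = int c * int q"
    using y t unfolding mult.commute[of "int q"] by linarith+
  then have "s = c" using q by simp
  have "int c * int r = int a + int \<rho>" using c by (metis of_nat_add of_nat_mult)
  then show "x = \<rho>" using x \<open>t = 1\<close> \<open>s = c\<close> by simp
  show "y = q * c + 1"
    using y \<open>t = 1\<close> \<open>s = c\<close> by (metis mult.commute of_nat_1 of_nat_add of_nat_eq_iff of_nat_mult)
qed

text \<open>This is the case where \<open>g\<close> is the residue 1. The lengths of two atoms show
  first that \<open>a\<close> and then that \<open>c\<close> is congruent to 1 modulo
  \<open>d\<close>. The remainder \<open>r\<close> is at most \<open>d\<close>, which sharpens the
  second congruence to \<open>a = (c - 1) * r + 1\<close>; inserting this into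
  \<open>n = q * a + r\<close> gives the formula.\<close>

lemma pair_relation_normalized:
  fixes n d a :: nat
  assumes p: "Factorial_Ring.prime n" and d: "2 * n\<^sup>2 \<le> d ^ 3" and a: "1 < a" "a < n"
    and len: "\<And>x y. \<lbrakk>0 < x + y; n dvd x + a * y;
      \<And>x' y'. \<lbrakk>x' \<le> x; y' \<le> y; 0 < x' + y'; n dvd x' + a * y'\<rbrakk> \<Longrightarrow> x' = x \<and> y' = y\<rbrakk>
      \<Longrightarrow> [x + y = n] (mod d)"
  obtains c1 c2 m where "0 < c1" "0 < c2" "0 < m" "n dvd c2 + a * c1" "n = c1 + c2 + m * d * c1 * c2"
proof -
  have d0: "d > 0" using d a by (cases d) auto
  \<comment> \<open>The first atom has \<open>n - a\<close> copies of 1 and one copy of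
    \<open>a\<close>; it yields \<open>d dvd a - 1\<close>.\<close>
  have "[(n - a) + 1 = n] (mod d)"
  proof (rule len)
    show "n dvd n - a + a * 1" using a by simp
    fix x' y' assume h: "x' \<le> n - a" "y' \<le> 1" "0 < x' + y'" "n dvd x' + a * y'"
    have "y' = 0 \<or> y' = 1" using h(2) by auto
    then show "x' = n - a \<and> y' = 1"
    proof
      assume "y' = 0" then show ?thesis using h a by (auto dest: dvd_imp_le)
    next
      assume "y' = 1"
      moreover have "n \<le> x' + a" using h calculation a by (intro dvd_imp_le) auto
      ultimately show ?thesis using h by simp
    qed
  qed (use a in auto)
  then have "[(n - a) + 1 + (a - 1) = n + (a - 1)] (mod d)" by (rule cong_add) simp
  then have "[n + 0 = n + (a - 1)] (mod d)" using a by simp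
  then have "[0 = a - 1] (mod d)" by (rule cong_add_lcancel_nat[THEN iffD1])
  then have da: "d dvd a - 1" using cong_0_iff cong_sym by blast
  then have dn: "d < n" using a by (auto dest!: dvd_imp_le)
  have cop: "coprime n d" using p dn d0 by (meson coprime_commute dvd_imp_le leD prime_imp_coprime)
  \<comment> \<open>Serves to bound the remainder \<open>r\<close> by \<open>d\<close>, through
    \<open>d * r < a < n\<close>.\<close>
  have dd: "n \<le> d * d"
  proof -
    have "2 * (n * n) \<le> d * d * d" using d by (simp add: power2_eq_square power3_eq_cube)
    also have "\<dots> \<le> d * d * n" using dn by (intro mult_le_mono) auto
    finally have "n * (2 * n) \<le> n * (d * d)" by (simp add: ac_simps)
    then show ?thesis using dn by simp
  qed
  define q r where "q = n div a" and "r = n mod a"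
  have n: "n = q * a + r" by (simp add: q_def r_def)
  have q: "q > 0" using a by (simp add: q_def div_greater_zero_iff)
  have ra: "r < a" using a by (simp add: r_def)
  have r: "r > 0"
  proof (rule ccontr)
    assume "\<not> r > 0"
    then have "a dvd n" by (auto simp: r_def)
    then show False using p a by (auto simp: prime_nat_iff)
  qed
  \<comment> \<open>\<open>c\<close> is the ceiling of \<open>a / r\<close>, and \<rho> is the
    amount by which \<open>c * r\<close> exceeds \<open>a\<close>.\<close>
  define c where "c = (a + r - 1) div r"
  define \<rho> where "\<rho> = c * r - a"
  have div: "c * r + (a + r - 1) mod r = a + r - 1" by (simp add: c_def)
  have "(a + r - 1) mod r < r" using r by simp
  then have "c * r \<ge> a" "c * r < a + r" using div r by linarith+
  then have c: "c * r = a + \<rho>" "\<rho> < r" by (auto simp: \<rho>_def)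
  have c2: "c \<ge> 2"
  proof (rule ccontr)
    assume "\<not> c \<ge> 2" then have "c \<le> 1" by simp
    then have "c * r \<le> r" by simp
    then show False using c ra by simp
  qed
  \<comment> \<open>The second atom has \<rho> copies of 1 and \<open>q * c + 1\<close> copies of
    \<open>a\<close>, with sum \<open>n * c\<close>.\<close>
  have "[\<rho> + (q * c + 1) = n] (mod d)"
  proof (rule len)
    have "\<rho> + a * (q * c + 1) = c * r + c * (q * a)" using c by (simp add: algebra_simps)
    also have "\<dots> = n * c" unfolding n by (simp add: algebra_simps)
    finally show "n dvd \<rho> + a * (q * c + 1)" by simp
  qed (use euclid_min_zero_sum[OF n r ra q c] in auto)
  have aeq: "[a = 1] (mod d)" using da a by (metis cong_altdef_nat cong_sym less_or_eq_imp_le)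
  \<comment> \<open>Adding \<open>a - 1\<close>, which is 0 modulo \<open>d\<close>, turns the
    length into \<open>c * (q + r)\<close>. As \<open>q + r\<close> is congruent to
    \<open>n\<close>, hence prime to \<open>d\<close>, it can be cancelled.\<close>
  have "[\<rho> + (q * c + 1) + (a - 1) = n + (a - 1)] (mod d)"
    using \<open>[\<rho> + (q * c + 1) = n] (mod d)\<close> by (rule cong_add) simp
  moreover have "\<rho> + (q * c + 1) + (a - 1) = c * (q + r)" using c a by (simp add: algebra_simps)
  moreover have "[n + (a - 1) = n + 0] (mod d)"
    by (intro cong_add cong_refl) (use da in \<open>simp add: cong_0_iff\<close>)
  moreover have "[n = q * 1 + r] (mod d)"
    unfolding n by (intro cong_add cong_mult aeq cong_refl)
  ultimately have "[c * (q + r) = 1 * (q + r)] (mod d)"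
    unfolding cong_def by simp
  moreover have "coprime (q + r) d"
    using cong_imp_coprime[OF \<open>[n = q * 1 + r] (mod d)\<close> cop] by simp
  ultimately have c1: "[c = 1] (mod d)" by (subst (asm) cong_mult_rcancel_nat)
  then have dc: "d dvd c - 1" using c2 by (meson cong_altdef_nat le_trans one_le_numeral)
  have dr: "d * r < a"
  proof -
    have "d \<le> c - 1" using dc c2 by (auto intro: dvd_imp_le)
    then have "d * r \<le> (c - 1) * r" by simp
    also have "(c - 1) * r < a" using c ra r by (simp add: algebra_simps)
    finally show ?thesis .
  qed
  have "r \<le> d"
  proof (rule ccontr)
    assume "\<not> r \<le> d"
    then have "d * d \<le> d * r" by simp
    then show False using dd dr a by linarith
  qed
  \<comment> \<open>Since \<open>c * r = a + \<rho>\<close> with \<open>a\<close> and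
    \<open>c\<close> congruent to 1, \<rho> is congruent to \<open>r - 1\<close>; both are below
    \<open>d\<close>, so they are equal.\<close>
  have "[a + \<rho> = r] (mod d)" using cong_mult[OF c1 cong_refl[of r d]] c(1) by simp
  then have "[a + \<rho> = 1 + (r - 1)] (mod d)" using r by simp
  moreover have "[a + \<rho> = 1 + \<rho>] (mod d)" using aeq by (intro cong_add cong_refl)
  ultimately have "[1 + \<rho> = 1 + (r - 1)] (mod d)" by (metis cong_sym cong_trans)
  then have "[\<rho> = r - 1] (mod d)" by (rule cong_add_lcancel_nat[THEN iffD1])
  then have \<rho>: "\<rho> = r - 1"
    using \<open>r \<le> d\<close> r c(2) by (intro cong_less_modulus_unique_nat[of \<rho> "r - 1" d]) auto
  obtain m where m: "c - 1 = d * m" using dc by (elim dvdE)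
  have "a = (c - 1) * r + 1" using c \<rho> r c2 a by (simp add: algebra_simps)
  then have am: "a = m * d * r + 1" using m by (simp add: ac_simps)
  show thesis
  proof
    show "0 < q" "0 < r" by fact+
    show "0 < m" using m c2 by (cases m) auto
    show "n dvd r + a * q" using n by (simp add: ac_simps)
    show "n = q + r + m * d * q * r" by (subst n, subst am) (simp add: algebra_simps)
  qed
qed

text \<open>The residue \<open>g\<close> is invertible modulo the prime \<open>n\<close>. Dividing
  by it replaces \<open>g\<close> by 1 and \<open>h\<close> by the residue \<open>a\<close> of
  \<open>h / g\<close>, which is neither 0 nor 1 since \<open>h\<close> is non-zero and distinct
  from \<open>g\<close>.\<close>

lemma pair_relation:
  fixes n d g h :: nat
  assumes p: "Factorial_Ring.prime n" and d: "2 * n\<^sup>2 \<le> d ^ 3"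
    and gh: "0 < g" "g < n" "0 < h" "h < n" "g \<noteq> h"
    and len: "\<And>B. \<lbrakk>set_mset B \<subseteq> {g, h}; min_zero_sum n B\<rbrakk> \<Longrightarrow> [size B = n] (mod d)"
  obtains c1 c2 m where "0 < c1" "0 < c2" "0 < m" "n dvd c2 * g + c1 * h" "n = c1 + c2 + m * d * c1 * c2"
proof -
  have cg: "coprime g n" 
    using p gh by (metis coprime_commute dvd_imp_le leD prime_imp_coprime)
  then obtain i where i: "[g * i = 1] (mod n)" using cong_solve_coprime_nat[of g n] by auto
  define a where "a = (i * h) mod n"
  have "[a = i * h] (mod n)" by (simp add: a_def)
  then have "[g * a = g * (i * h)] (mod n)" by (rule cong_scalar_left)
  moreover have "[(g * i) * h = 1 * h] (mod n)" using i by (rule cong_scalar_right)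
  ultimately have ga: "[g * a = h] (mod n)" by (metis cong_trans mult.assoc mult_1)
  have a0: "a \<noteq> 0"
  proof
    assume "a = 0"
    then have "[h = 0] (mod n)" using ga by (simp add: cong_sym)
    then show False using gh by (simp add: cong_0_iff dvd_imp_le leD nat_dvd_not_less)
  qed
  have a1: "a \<noteq> 1"
  proof
    assume "a = 1"
    then have "[g = h] (mod n)" using ga by simp
    then show False using gh cong_less_modulus_unique_nat by blast
  qed
  have an: "a < n" using gh by (simp add: a_def)
  have dv: "n dvd x * g + y * h \<longleftrightarrow> n dvd x + a * y" for x y
  proof -
    have "[g * (x + a * y) = x * g + y * h] (mod n)"
    proof -
      have "[x * g + y * (g * a) = x * g + y * h] (mod n)"
        using ga by (intro cong_add cong_mult cong_refl)
      moreover have "g * (x + a * y) = x * g + y * (g * a)" by (simp add: algebra_simps)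
      ultimately show ?thesis by metis
    qed
    then have "n dvd x * g + y * h \<longleftrightarrow> n dvd g * (x + a * y)" by (meson cong_dvd_iff cong_sym)
    also have "\<dots> \<longleftrightarrow> n dvd x + a * y" using cg by (simp add: coprime_commute coprime_dvd_mult_right_iff)
    finally show ?thesis .
  qed
  have a': "1 < a" using a0 a1 by simp
  show thesis
  proof (rule pair_relation_normalized[OF p d a' an])
    fix x y
    assume "0 < x + y" "n dvd x + a * y"
      "\<And>x' y'. \<lbrakk>x' \<le> x; y' \<le> y; 0 < x' + y'; n dvd x' + a * y'\<rbrakk> \<Longrightarrow> x' = x \<and> y' = y"
    then have "min_zero_sum n (replicate_mset x g + replicate_mset y h)"
      using dv by (subst min_zero_sum_two[OF gh(5)]) blast
    moreover have "set_mset (replicate_mset x g + replicate_mset y h) \<subseteq> {g, h}"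
      by (auto simp: set_mset_replicate_mset_subset)
    ultimately have "[size (replicate_mset x g + replicate_mset y h) = n] (mod d)"
      by (intro len)
    then show "[x + y = n] (mod d)" by simp
  qed (use that dv in blast)
qed

section \<open>Incompatibility of three relations\<close>

lemma no_three_relations:
  fixes n d g h k :: nat
  assumes p: "Factorial_Ring.prime n" and d: "2 * n\<^sup>2 \<le> d ^ 3" and h: "0 < h" "h < n"
    and pos: "0 < b1" "0 < b2" "0 < c1" "0 < c2" "0 < e1" "0 < e2"
    and small: "d * b1 * b2 < n" "d * c1 * c2 < n" "d * e1 * e2 < n"
    and rel: "n dvd b2 * g + b1 * h" "n dvd c2 * g + c1 * k" "n dvd e2 * h + e1 * k"
  shows False
proof -
  \<comment> \<open>These are the coefficients left on \<open>h\<close> once \<open>g\<close> and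
    \<open>k\<close> are eliminated; their product contains each of the six given coefficients
    exactly once.\<close>
  define X Y where "X = b1 * c2 * e1" and "Y = b2 * c1 * e2"
  have dvd: "n dvd h * (X + Y)"
  proof -
    have "int n dvd int b2 * int g + int b1 * int h" "int n dvd int c2 * int g + int c1 * int k"
      "int n dvd int e2 * int h + int e1 * int k"
      using rel by (metis int_dvd_int_iff of_nat_add of_nat_mult)+
    then have "int n dvd (int c2 * int e1) * (int b2 * int g + int b1 * int h) 
        - (int b2 * int e1) * (int c2 * int g + int c1 * int k)
        + (int b2 * int c1) * (int e2 * int h + int e1 * int k)"
      by (rule dvd_add[OF dvd_diff[OF dvd_mult dvd_mult] dvd_mult])
    also have "\<dots> = int (h * (X + Y))" by (simp add: X_def Y_def algebra_simps)
    finally show ?thesis by presburger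
  qed
  moreover have "coprime n h" using p h by (metis dvd_imp_le leD prime_imp_coprime)
  ultimately have "n dvd X + Y" by (simp add: coprime_dvd_mult_right_iff)
  moreover have XY: "X \<ge> 1" "Y \<ge> 1" using pos by (simp_all add: X_def Y_def Suc_leI)
  ultimately have "n \<le> X + Y" by (intro dvd_imp_le) auto
  \<comment> \<open>Dropping the non-negative first summand leaves
    \<open>X + Y \<le> X * Y + 1\<close>.\<close>
  moreover have "(X - 1) * (Y - 1) + (X + Y) = X * Y + 1"
    using XY by (auto simp: le_iff_add algebra_simps)
  ultimately have *: "n \<le> X * Y + 1" by linarith
  \<comment> \<open>The product of the three strict bounds confines \<open>d ^ 3 * (X * Y)\<close>
    to the cube of \<open>n - 1\<close>, while \<open>X * Y \<ge> n - 1\<close> makes it at least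
    \<open>2 * n\<^sup>2 * (n - 1)\<close>.\<close>
  have "d * b1 * b2 * (d * c1 * c2) * (d * e1 * e2) \<le> (n - 1) * (n - 1) * (n - 1)"
    using small by (intro mult_le_mono) auto
  moreover have "d * b1 * b2 * (d * c1 * c2) * (d * e1 * e2) = d ^ 3 * (X * Y)"
    by (simp add: X_def Y_def power3_eq_cube ac_simps)
  moreover have "2 * n\<^sup>2 * (n - 1) \<le> d ^ 3 * (X * Y)" using d * by (intro mult_le_mono) auto
  ultimately have "2 * n\<^sup>2 * (n - 1) \<le> (n - 1) * (n - 1) * (n - 1)" by linarith
  moreover have "n \<ge> 2" using p by (simp add: prime_ge_2_nat)
  ultimately have "2 * n\<^sup>2 \<le> (n - 1) * (n - 1)" by simp
  also have "\<dots> \<le> n * n" by (intro mult_le_mono) auto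
  finally show False using \<open>n \<ge> 2\<close> by (simp add: power2_eq_square)
qed

section \<open>Atoms over two classes that satisfy the relation\<close>

text \<open>
  Besides \<open>(c2, c1)\<close>, the minimal solutions with \<open>k > 0\<close> are \<open>(c2 + k (1 + D c2), c1 - k)\<close> for \<open>k \<le> c1\<close>.
\<close>

lemma two_class_minimal_aux:
  fixes n c1 c2 D x y k :: nat
  assumes cop: "coprime c1 c2" and pos: "0 < c1" "0 < c2"
    and n: "n = c1 + c2 + D * c1 * c2" 
    and xy: "0 < x + y" "x * c1 = y * c2 + n * k"
    and min: "\<And>x' y' k'. \<lbrakk>x' \<le> x; y' \<le> y; 0 < x' + y'; x' * c1 = y' * c2 + n * k'\<rbrakk>
      \<Longrightarrow> x' = x \<and> y' = y"
  shows "[x + y = n] (mod D)"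
proof (cases "y < c1")
  \<comment> \<open>Here \<open>x * c1 \<ge> y * c2 \<ge> c1 * c2\<close>, so the solution
    \<open>(c2, c1)\<close> with \<open>k = 0\<close> lies below \<open>(x, y)\<close>, and
    minimality makes them equal.\<close>
  case False
  have "c2 * c1 \<le> x * c1" using False xy(2) by (simp add: mult.commute mult_le_mono trans_le_add1)
  then have "c2 \<le> x" using pos by simp
  then have "c2 = x \<and> c1 = y" using False pos by (intro min[of _ _ 0]) auto
  then have "n = x + y + D * (c1 * c2)" by (simp add: n)
  then show ?thesis by (simp add: cong_def)
next
  case True
  \<comment> \<open>Modulo \<open>c1\<close> the number \<open>n\<close> is \<open>c2\<close>, so
    \<open>c1\<close> divides \<open>c2 * (y + k)\<close>, hence \<open>y + k\<close>; this gives
    \<open>k \<ge> c1 - y\<close>.\<close>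
  have "x * c1 = c2 * (y + k) + (k * c1 + D * c2 * k * c1)" using xy(2) unfolding n by (simp add: algebra_simps)
  moreover have "c1 dvd x * c1" "c1 dvd k * c1 + D * c2 * k * c1" by simp_all
  ultimately have "c1 dvd c2 * (y + k)" by (metis dvd_add_left_iff)
  then have cyk: "c1 dvd y + k" using cop by (simp add: coprime_dvd_mult_right_iff)
  have "y + k > 0" using xy pos by (cases "y + k") auto
  then have ck: "c1 \<le> y + k" using cyk by (simp add: dvd_imp_le)
  define k' where "k' = c1 - y"
  have c1: "c1 = y + k'" using True by (simp add: k'_def)
  \<comment> \<open>This is the solution with the same \<open>y\<close> and the least possible
    \<open>k\<close>. It lies below \<open>(x, y)\<close>, so minimality identifies the two.\<close>
  define x' where "x' = c2 + k' * (1 + D * c2)"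
  have x': "x' * c1 = y * c2 + n * k'"
  proof -
    have "x' * c1 = c2 * (y + k') + k' * (1 + D * c2) * c1" unfolding x'_def by (simp add: algebra_simps c1)
    also have "\<dots> = y * c2 + n * k'" unfolding n by (simp add: algebra_simps)
    finally show ?thesis .
  qed
  have "x' * c1 \<le> x * c1" unfolding x' xy(2) using ck c1 by simp
  then have "x' \<le> x" using pos by simp
  then have "x' = x" using min[OF _ _ _ x'] pos by (simp add: x'_def)
  then have "x + y = c1 + c2 + D * (c2 * k')" unfolding c1 by (simp add: x'_def algebra_simps)
  moreover have "n = c1 + c2 + D * (c1 * c2)" by (simp add: n)
  ultimately show ?thesis by (simp add: cong_def)
qed

text \<open>The relation says that \<open>c1 * h\<close> is \<open>- c2 * g\<close> modulo
  \<open>n\<close>, so multiplying by the unit \<open>c1\<close> turns the zero sum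
  \<open>u * g + v * h\<close> into a congruence between \<open>u * c1\<close> and
  \<open>v * c2\<close>. The sign of their difference decides in which of two symmetric orientations
  the previous lemma applies.\<close>

lemma two_class_minimal:
  fixes n c1 c2 d g h x y m :: nat
  assumes p: "Factorial_Ring.prime n" and gh: "0 < g" "g < n" "0 < h" "h < n" "g \<noteq> h"
    and pos: "0 < c1" "0 < c2"
    and n: "n = c1 + c2 + m * d * c1 * c2" and rel: "n dvd c2 * g + c1 * h"
    and min: "min_zero_sum n (replicate_mset x g + replicate_mset y h)"
  shows "[x + y = n] (mod d)"
proof -
  \<comment> \<open>A common divisor divides the prime \<open>n\<close> but is at most
    \<open>c1 < n\<close>.\<close>
  have cop: "coprime c1 c2"
  proof (rule coprimeI)
    fix l assume l: "l dvd c1" "l dvd c2"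
    then have "l dvd n" unfolding n by (intro dvd_add) auto
    then have "l = 1 \<or> l = n" using p by (auto simp: prime_nat_iff)
    moreover have "l \<le> c1" using l pos by (auto intro: dvd_imp_le)
    moreover have "c1 < n" using n pos by simp
    ultimately show "is_unit l" by auto
  qed
  have "coprime n g" "coprime n c1" using p gh pos n by (auto intro!: prime_imp_coprime dest!: dvd_imp_le)
  have dv: "n dvd u * g + v * h \<longleftrightarrow> int n dvd int u * int c1 - int v * int c2" for u v
  proof -
    have "int c1 * (int u * int g + int v * int h) 
      = int g * (int u * int c1 - int v * int c2) + int v * (int c2 * int g + int c1 * int h)"
      by (simp add: algebra_simps)
    moreover have "int n dvd int v * (int c2 * int g + int c1 * int h)"
      using rel by (metis dvd_mult int_dvd_int_iff of_nat_add of_nat_mult)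
    ultimately have "int n dvd int c1 * (int u * int g + int v * int h)
        \<longleftrightarrow> int n dvd int g * (int u * int c1 - int v * int c2)"
      by (metis dvd_add_left_iff)
    then have "int n dvd int u * int g + int v * int h \<longleftrightarrow> int n dvd int u * int c1 - int v * int c2"
      using \<open>coprime n g\<close> \<open>coprime n c1\<close> by (simp add: coprime_dvd_mult_right_iff)
    then show ?thesis by (metis int_dvd_int_iff of_nat_add of_nat_mult)
  qed
  have one: "n dvd u * g + v * h" if "u * c1 = v * c2 + n * k" for u v k
  proof -
    have "int u * int c1 - int v * int c2 = int n * int k" using that
      by (metis add_diff_cancel_left' of_nat_add of_nat_mult)
    then show ?thesis by (simp add: dv)
  qed
  have two: "n dvd u * g + v * h" if "v * c2 = u * c1 + n * k" for u v k
  proof -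
    have "int v * int c2 = int u * int c1 + int n * int k" using that by (metis of_nat_add of_nat_mult)
    then have "int u * int c1 - int v * int c2 = int n * (- int k)" by simp
    then show ?thesis unfolding dv by (metis dvd_triv_left)
  qed
  from min have xy: "0 < x + y" "n dvd x * g + y * h"
    and mini: "\<And>x' y'. \<lbrakk>x' \<le> x; y' \<le> y; 0 < x' + y'; n dvd x' * g + y' * h\<rbrakk> \<Longrightarrow> x' = x \<and> y' = y"
    unfolding min_zero_sum_two[OF gh(5)] by blast+
  obtain z where z: "int x * int c1 - int y * int c2 = int n * z"
    using xy(2) unfolding dv by (elim dvdE)
  have "[x + y = n] (mod (m * d))"
  proof (cases "z \<ge> 0")
    case True
    then have "int (x * c1) = int (y * c2 + n * nat z)" using z by simp
    then have eq: "x * c1 = y * c2 + n * nat z" by presburger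
    show ?thesis
      by (rule two_class_minimal_aux[OF cop pos n xy(1) eq]) (use mini one in blast)
  next
    case False
    then have "int (y * c2) = int (x * c1 + n * nat (-z))" using z by simp
    then have eq: "y * c2 = x * c1 + n * nat (-z)" by presburger
    have "[y + x = n] (mod (m * d))"
    proof (rule two_class_minimal_aux[OF _ pos(2) pos(1) _ _ eq])
      show "coprime c2 c1" using cop by (simp add: coprime_commute)
      show "n = c2 + c1 + m * d * c2 * c1" by (simp add: n ac_simps)
      show "0 < y + x" using xy(1) by linarith
      fix y' x' k' assume "y' \<le> y" "x' \<le> x" "0 < y' + x'" "y' * c2 = x' * c1 + n * k'"
      moreover from this have "n dvd x' * g + y' * h" by (intro two[of y' x' k'])
      ultimately show "y' = y \<and> x' = x" using mini[of x' y'] by linarith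
    qed
    then show ?thesis by (simp add: add.commute)
  qed
  then show ?thesis by (rule cong_dvd_modulus_nat) simp
qed

section \<open>Atoms over a single class\<close>

lemma min_zero_sum_replicate:
  assumes p: "Factorial_Ring.prime n" and g: "0 < g" "g < n"
  shows "min_zero_sum n (replicate_mset n g)"
proof -
  have cop: "coprime n g" using p g by (auto intro!: prime_imp_coprime dest!: dvd_imp_le)
  have "C = replicate_mset n g"
    if C: "C \<subseteq># replicate_mset n g" "C \<noteq> {#}" "n dvd \<Sum>\<^sub># C" for C
  proof -
    obtain k where k: "k \<le> n" "C = replicate_mset k g"
      using C(1) by (rule msubseteq_replicate_msetE)
    then have "n dvd k" "k > 0" using C cop by (auto simp: coprime_dvd_mult_left_iff gr0_conv_Suc intro: Suc_pred')
    then have "k = n" using k by (auto dest: dvd_imp_le)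
    then show ?thesis using k by simp
  qed
  then show ?thesis using g by (auto simp: min_zero_sum_def replicate_mset_eq_empty_iff)
qed

text \<open>Such a \<open>B\<close> contains the zero-sum multiset of \<open>n\<close> copies of
  \<open>g\<close> and by minimality equals it. Hence a single non-zero class would produce atoms of
  only one length.\<close>

lemma min_zero_sum_one_class:
  assumes p: "Factorial_Ring.prime n" and g: "0 < g" "g < n"
    and B: "set_mset B \<subseteq> {g}" "min_zero_sum n B"
  shows "size B = n"
proof -
  have cop: "coprime n g" using p g by (auto intro!: prime_imp_coprime dest!: dvd_imp_le)
  obtain k where k: "B = replicate_mset k g" using B(1) by (metis set_mset_subset_singletonD)
  then have "k > 0" "n dvd k"
    using B(2) cop by (auto simp: min_zero_sum_def coprime_dvd_mult_left_iff replicate_mset_eq_empty_iff)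
  then have "n \<le> k" by (auto intro: dvd_imp_le)
  then have "replicate_mset n g \<subseteq># B" unfolding k by (simp add: subseteq_mset_def)
  moreover have "replicate_mset n g \<noteq> {#}" "n dvd \<Sum>\<^sub># (replicate_mset n g)"
    using g by (auto simp: replicate_mset_eq_empty_iff)
  ultimately have "replicate_mset n g = B" using B(2) unfolding min_zero_sum_def by blast
  then show ?thesis by (metis size_replicate_mset)
qed

section \<open>Transfer of factorizations from \<open>H\<close> to weight multisets\<close>

text \<open>This abstracts from the class group: \<open>w p\<close> stands for the discrete
  logarithm of the class of \<open>p\<close>, and \<open>image_iff\<close> expresses that an
  effective divisor comes from \<open>H\<close> exactly when its class is trivial.\<close>

locale divisor_weights = comm_monoid_cancel H
  for H :: "('a, 'm) monoid_scheme" (structure) +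
  fixes P :: "'p set" and \<phi> :: "'a \<Rightarrow> 'p multiset" and n :: nat and w :: "'p \<Rightarrow> nat"
  assumes hom: "divisor_homomorphism H P \<phi>"
    and image_iff: "\<And>M. set_mset M \<subseteq> P \<Longrightarrow> M \<in> \<phi> ` carrier H \<longleftrightarrow> n dvd (\<Sum>p\<in>#M. w p)"
begin

definition atoms :: "'p multiset set" where
  "atoms = {M. set_mset M \<subseteq> P \<and> min_zero_sum n (image_mset w M)}"

lemma set_phi: "a \<in> carrier H \<Longrightarrow> set_mset (\<phi> a) \<subseteq> P"
  using hom by (auto simp: divisor_homomorphism_def hom_def free_abelian_monoid_def Pi_iff)

lemma phi_mult: "a \<in> carrier H \<Longrightarrow> b \<in> carrier H \<Longrightarrow> \<phi> (a \<otimes> b) = \<phi> a + \<phi> b"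
  using hom by (auto simp: divisor_homomorphism_def hom_def free_abelian_monoid_def)

lemma phi_one: "\<phi> \<one> = {#}"
  using phi_mult[of \<one> \<one>] by simp

lemma divides_iff:
  assumes "a \<in> carrier H" "b \<in> carrier H"
  shows "a divides b \<longleftrightarrow> \<phi> a \<subseteq># \<phi> b"
  using hom assms divides_free_abelian_monoid[OF set_phi[OF assms(2)], of "\<phi> a"]
  by (auto simp: divisor_homomorphism_def)

lemma Units_iff: "a \<in> carrier H \<Longrightarrow> a \<in> Units H \<longleftrightarrow> \<phi> a = {#}"
  by (simp add: Unit_eq_dividesone divides_iff phi_one)

lemma zero_sum_phi: "a \<in> carrier H \<Longrightarrow> n dvd (\<Sum>p\<in>#\<phi> a. w p)"
  using image_iff[OF set_phi] by blast

lemma atoms_nonempty: "{#} \<notin> atoms"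
  by (simp add: atoms_def min_zero_sum_def)

text \<open>Divisors of \<open>a\<close> correspond, up to units, to the zero-sum parts of
  \<open>\<phi> a\<close>, because \<phi> reflects divisibility and every zero-sum divisor lies in
  its image.\<close>

lemma irreducible_iff:
  assumes a: "a \<in> carrier H"
  shows "Divisibility.irreducible H a \<longleftrightarrow> \<phi> a \<in> atoms"
proof
  assume irr: "Divisibility.irreducible H a"
  have ne: "\<phi> a \<noteq> {#}" using irr a by (auto simp: Divisibility.irreducible_def Units_iff)
  have "C = image_mset w (\<phi> a)"
    if C: "C \<subseteq># image_mset w (\<phi> a)" "C \<noteq> {#}" "n dvd \<Sum>\<^sub># C" for C
  proof -
    \<comment> \<open>The submultiset of weights is lifted to a part of the divisor
      \<open>\<phi> a\<close>, which has a preimage in \<open>H\<close> because its weights sum to 0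
      modulo \<open>n\<close>.\<close>
    obtain D where D: "D \<subseteq># \<phi> a" "image_mset w D = C"
      using C(1) image_mset_eq_plusD[of w "\<phi> a"] by (metis mset_subset_eq_exists_conv mset_subset_eq_add_left)
    then have "set_mset D \<subseteq> P" using set_phi[OF a] by (meson order_trans set_mset_mono)
    then obtain b where b: "b \<in> carrier H" "\<phi> b = D" using image_iff[of D] C(3) D(2) by auto
    have "b \<notin> Units H" using b C(2) D(2) by (auto simp: Units_iff)
    then have "\<not> properfactor H b a" using irr b by (auto simp: Divisibility.irreducible_def)
    then have "\<phi> a \<subseteq># D" using D b a by (auto simp: properfactor_def divides_iff)
    then show ?thesis using D by (auto dest: subset_mset.antisym)
  qed
  then show "\<phi> a \<in> atoms"
    using ne set_phi[OF a] zero_sum_phi[OF a] by (auto simp: atoms_def min_zero_sum_def)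
next
  assume at: "\<phi> a \<in> atoms"
  then have "a \<notin> Units H" using a atoms_nonempty by (auto simp: Units_iff)
  moreover have "b \<in> Units H" if b: "b \<in> carrier H" "properfactor H b a" for b
  proof (rule ccontr)
    assume "b \<notin> Units H"
    then have ne: "image_mset w (\<phi> b) \<noteq> {#}" using b by (simp add: Units_iff)
    have sub: "\<phi> b \<subseteq># \<phi> a" "\<not> \<phi> a \<subseteq># \<phi> b" using b a by (auto simp: properfactor_def divides_iff)
    have "image_mset w (\<phi> b) = image_mset w (\<phi> a)"
      using at ne zero_sum_phi[OF b(1)] image_mset_subseteq_mono[OF sub(1), of w]
      unfolding atoms_def min_zero_sum_def by blast
    \<comment> \<open>Distinct prime divisors may share a weight, so equal weight multisets give
      only equal sizes; together with the inclusion this suffices.\<close>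
    then have "size (\<phi> b) = size (\<phi> a)" by (metis size_image_mset)
    then have "\<phi> b = \<phi> a" using sub(1) by (metis mset_subset_size nless_le subset_mset.nless_le)
    then show False using sub(2) by simp
  qed
  ultimately show "Divisibility.irreducible H a" by (auto simp: Divisibility.irreducible_def)
qed

lemma phi_foldr:
  "set fs \<subseteq> carrier H \<Longrightarrow>
    foldr (\<otimes>) fs \<one> \<in> carrier H \<and> \<phi> (foldr (\<otimes>) fs \<one>) = \<Sum>\<^sub># (mset (map \<phi> fs))"
  by (induction fs) (auto simp: phi_one phi_mult)

text \<open>Applying \<phi> to a factorization loses only units. Conversely, preimages of the given
  atoms have a product associated to \<open>a\<close>, and the unit can be absorbed into one
  factor.\<close>

lemma lengths_eq:
  assumes a: "a \<in> carrier H"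
  shows "lengths H a = {size X |X. set_mset X \<subseteq> atoms \<and> \<Sum>\<^sub># X = \<phi> a}"
proof (cases "a \<in> Units H")
  case True
  \<comment> \<open>For a unit only the empty multiset of atoms has the right sum, in agreement with
    the value \<open>{0}\<close> set by convention.\<close>
  have "X = {#}" if "set_mset X \<subseteq> atoms" "\<Sum>\<^sub># X = {#}" for X
  proof (rule ccontr)
    assume "X \<noteq> {#}"
    then obtain M where "M \<in># X" by blast
    then show False using that atoms_nonempty by auto
  qed
  then have "{size X |X. set_mset X \<subseteq> atoms \<and> \<Sum>\<^sub># X = {#}} = {0}" by force
  then show ?thesis using True a by (simp add: lengths_def Units_iff)
next
  case False
  have "\<exists>X. length fs = size X \<and> set_mset X \<subseteq> atoms \<and> \<Sum>\<^sub># X = \<phi> a"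
    if fs: "set fs \<subseteq> carrier H" "factors H fs a" for fs
  proof (intro exI conjI)
    show "length fs = size (mset (map \<phi> fs))" by simp
    show "set_mset (mset (map \<phi> fs)) \<subseteq> atoms"
      using fs irreducible_iff by (auto simp: factors_def)
    show "\<Sum>\<^sub># (mset (map \<phi> fs)) = \<phi> a"
      using phi_foldr[OF fs(1)] fs(2) by (simp add: factors_def)
  qed
  moreover have "\<exists>fs. size X = length fs \<and> set fs \<subseteq> carrier H \<and> factors H fs a"
    if X: "set_mset X \<subseteq> atoms" "\<Sum>\<^sub># X = \<phi> a" for X
  proof -
    define f where "f M = inv_into (carrier H) \<phi> M" for M
    have f: "f M \<in> carrier H" "\<phi> (f M) = M" if "M \<in> atoms" for M
    proof -
      have "M \<in> \<phi> ` carrier H" using that image_iff[of M] by (auto simp: atoms_def min_zero_sum_def)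
      then show "f M \<in> carrier H" "\<phi> (f M) = M"
        unfolding f_def by (simp_all add: inv_into_into f_inv_into_f)
    qed
    obtain Ms where Ms: "mset Ms = X" using ex_mset by blast
    define fs where "fs = map f Ms"
    have sMs: "set Ms \<subseteq> atoms" using X(1) Ms by auto
    have carr: "set fs \<subseteq> carrier H" using sMs f by (auto simp: fs_def)
    have "map \<phi> fs = Ms" using sMs f by (auto simp: fs_def intro!: map_idI)
    then have prod: "\<phi> (foldr (\<otimes>) fs \<one>) = \<phi> a" "foldr (\<otimes>) fs \<one> \<in> carrier H"
      using phi_foldr[OF carr] X(2) Ms by auto
    define b where "b = foldr (\<otimes>) fs \<one>"
    have fac: "factors H fs b"
      using sMs f irreducible_iff by (auto simp: factors_def b_def fs_def)
    have b: "b \<in> carrier H" "b \<notin> Units H"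
      using prod False a by (auto simp: b_def Units_iff)
    have "a \<sim> b" using prod a b by (auto simp: associated_def divides_iff b_def)
    then obtain u where u: "a = b \<otimes> u" "u \<in> Units H" using a b by (auto elim: associatedE2)
    \<comment> \<open>The unit \<open>u\<close> is absorbed into the first factor.\<close>
    define gs where "gs = fs[0 := fs ! 0 \<otimes> u]"
    have "factors H gs a" unfolding gs_def u(1) by (rule factors_cong_unit[OF u(2) b(2) fac carr])
    moreover have "set gs \<subseteq> carrier H"
    proof (cases fs)
      case (Cons c cs)
      then show ?thesis using carr u by (auto simp: gs_def)
    qed (simp add: gs_def)
    moreover have "size X = length gs" using Ms by (auto simp: gs_def fs_def)
    ultimately show ?thesis by blast
  qed
  ultimately have "{length fs |fs. set fs \<subseteq> carrier H \<and> factors H fs a}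
      = {size X |X. set_mset X \<subseteq> atoms \<and> \<Sum>\<^sub># X = \<phi> a}"
    by blast
  then show ?thesis using False by (simp add: lengths_def)
qed

lemma congruence_half_factorial_iff:
  "congruence_half_factorial d H \<longleftrightarrow>
    (\<forall>X Y. set_mset X \<subseteq> atoms \<longrightarrow> set_mset Y \<subseteq> atoms \<longrightarrow> \<Sum>\<^sub># X = \<Sum>\<^sub># Y \<longrightarrow> [size X = size Y] (mod d))"
    (is "_ \<longleftrightarrow> ?R")
proof
  assume L: "congruence_half_factorial d H"
  show ?R
  proof (intro allI impI)
    fix X Y assume XY: "set_mset X \<subseteq> atoms" "set_mset Y \<subseteq> atoms" "\<Sum>\<^sub># X = \<Sum>\<^sub># Y"
    have "set_mset (\<Sum>\<^sub># X) \<subseteq> P \<and> n dvd (\<Sum>p\<in>#\<Sum>\<^sub># X. w p)"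
      using XY(1) by (induction X) (auto simp: atoms_def min_zero_sum_def)
    then obtain a where a: "a \<in> carrier H" "\<phi> a = \<Sum>\<^sub># X" using image_iff by (metis imageE)
    then have "size X \<in> lengths H a" "size Y \<in> lengths H a"
      using XY by (auto simp: lengths_eq)
    then show "[size X = size Y] (mod d)"
      using L a unfolding congruence_half_factorial_def by blast
  qed
next
  assume ?R
  then show "congruence_half_factorial d H"
    unfolding congruence_half_factorial_def by (fastforce simp: lengths_eq)
qed

text \<open>A non-minimal zero-sum divisor splits into two smaller ones, so induction on the size
  applies. This gives existence of factorizations, which half-factoriality requires besides
  uniqueness of the length.\<close>

lemma zero_sum_is_sum_of_atoms:
  "set_mset M \<subseteq> P \<Longrightarrow> n dvd (\<Sum>p\<in>#M. w p) \<Longrightarrow> \<exists>X. set_mset X \<subseteq> atoms \<and> \<Sum>\<^sub># X = M"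
proof (induction M rule: measure_induct_rule[of size])
  case (less M)
  consider "M = {#}" | "M \<in> atoms" | "M \<noteq> {#}" "M \<notin> atoms" by blast
  then show ?case
  proof cases
    case 1
    then show ?thesis by (intro exI[of _ "{#}"]) simp
  next
    case 2
    then show ?thesis by (intro exI[of _ "{#M#}"]) simp
  next
    case 3
    then obtain C where C: "C \<subseteq># image_mset w M" "C \<noteq> {#}" "n dvd \<Sum>\<^sub># C" "C \<noteq> image_mset w M"
      using less.prems by (auto simp: atoms_def min_zero_sum_def)
    obtain D E where M: "M = D + E" and D: "image_mset w D = C"
      using C(1) image_mset_eq_plusD[of w M] by (metis mset_subset_eq_exists_conv)
    have ne: "D \<noteq> {#}" "E \<noteq> {#}" using C D M by auto
    have E: "n dvd (\<Sum>p\<in>#E. w p)"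
      using less.prems(2) C(3) D M by (simp add: dvd_add_right_iff)
    obtain X where "set_mset X \<subseteq> atoms" "\<Sum>\<^sub># X = D"
      using less.IH[of D] less.prems ne C(3) D M by (auto simp: nonempty_has_size)
    moreover obtain Y where "set_mset Y \<subseteq> atoms" "\<Sum>\<^sub># Y = E"
      using less.IH[of E] less.prems ne E M by (auto simp: nonempty_has_size)
    ultimately show ?thesis using M by (intro exI[of _ "X + Y"]) simp
  qed
qed

text \<open>Congruence modulo 0 is equality, so the criterion for congruences also serves to prove
  half-factoriality.\<close>

lemma half_factorial_if_congruence_zero:
  assumes "congruence_half_factorial 0 H"
  shows "half_factorial H"
  unfolding half_factorial_def
proof
  fix a assume a: "a \<in> carrier H"
  obtain X where "set_mset X \<subseteq> atoms" "\<Sum>\<^sub># X = \<phi> a"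
    using zero_sum_is_sum_of_atoms[OF set_phi zero_sum_phi] a by blast
  then have "size X \<in> lengths H a" using a by (auto simp: lengths_eq)
  moreover have "l = l'" if "l \<in> lengths H a" "l' \<in> lengths H a" for l l'
  proof -
    have "[l = l'] (mod 0)" using assms that a unfolding congruence_half_factorial_def by blast
    then show ?thesis by (simp add: cong_def)
  qed
  ultimately have "lengths H a = {size X}" by blast
  then show "card (lengths H a) = 1" by simp
qed

text \<open>An atom \<open>A\<close> satisfies \<open>A\<^sup>n = \<Prod> p\<^sup>n\<close>, where \<open>p\<close> runs through the prime divisors in \<open>A\<close>.\<close>

lemma size_atom_cong:
  assumes p: "Factorial_Ring.prime n" and w: "\<And>p. p \<in> P \<Longrightarrow> w p < n"
    and chf: "congruence_half_factorial d H"
    and B: "set_mset B \<subseteq> w ` P - {0}" "min_zero_sum n B"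
  shows "[size B = n] (mod d)"
proof -
  \<comment> \<open>One prime divisor is chosen for each weight in order to lift \<open>B\<close> to
    a divisor.\<close>
  define M where "M = image_mset (inv_into P w) B"
  have wM: "image_mset w M = B"
    unfolding M_def image_mset.compositionality using B(1)
    by (intro image_mset_cong[of B _ id, simplified]) (auto simp: f_inv_into_f)
  have MP: "set_mset M \<subseteq> P" using B(1) by (auto simp: M_def inv_into_into)
  define X where "X = replicate_mset n M"
  define Y where "Y = image_mset (replicate_mset n) M"
  have "M \<in> atoms" using wM MP B(2) by (simp add: atoms_def)
  then have "set_mset X \<subseteq> atoms" by (auto simp: X_def)
  moreover have "set_mset Y \<subseteq> atoms"
  proof
    fix N assume "N \<in> set_mset Y"
    then obtain q where q: "q \<in># M" "N = replicate_mset n q" by (auto simp: Y_def)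
    have "q \<in> P" using q MP by auto
    moreover have "w q \<in># B" using q wM by auto
    ultimately show "N \<in> atoms"
      using q B(1) w min_zero_sum_replicate[OF p, of "w q"] by (auto simp: atoms_def)
  qed
  moreover have "\<Sum>\<^sub># X = repeat_mset n M" unfolding X_def by (induction n) auto
  moreover have "\<Sum>\<^sub># Y = repeat_mset n M" unfolding Y_def by (induction M) auto
  ultimately have "[size Y = size X] (mod d)" using chf unfolding congruence_half_factorial_iff by simp
  moreover have "size Y = size B" using wM by (auto simp: Y_def)
  ultimately show ?thesis by (simp add: X_def)
qed

text \<open>The map counting a principal prime divisor \<open>n\<close> times and any other one once is additive and
  congruent to \<open>n\<close> on every atom.\<close>

lemma congruence_half_factorialI:
  assumes cancel: "\<And>s t. [n * s = n * t] (mod d) \<Longrightarrow> [s = t] (mod d)"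
    and len: "\<And>B. set_mset B \<subseteq> w ` P - {0} \<Longrightarrow> min_zero_sum n B \<Longrightarrow> [size B = n] (mod d)"
  shows "congruence_half_factorial d H"
proof -
  define \<nu> where "\<nu> M = (\<Sum>p\<in>#M. if w p = 0 then n else 1)" for M
  have atom: "[\<nu> M = n] (mod d)" if M: "M \<in> atoms" for M
  proof (cases "\<exists>q\<in>#M. w q = 0")
    case True
    then obtain q where q: "q \<in># M" "w q = 0" by blast
    \<comment> \<open>The weight 0 alone is already a zero-sum multiset, so minimality reduces the
      atom to this one principal prime divisor, on which \<nu> takes the value
      \<open>n\<close>.\<close>
    then have "{#0#} \<subseteq># image_mset w M" by force
    moreover have "{#0::nat#} \<noteq> {#}" "n dvd \<Sum>\<^sub># {#0#}" by simp_all
    ultimately have "{#0#} = image_mset w M" using M unfolding atoms_def min_zero_sum_def by blast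
    then have "size M = 1" by (metis One_nat_def size_image_mset size_single)
    then have "M = {#q#}" using q by (metis size_1_singleton_mset set_mset_single singletonD)
    then show ?thesis using q by (simp add: \<nu>_def)
  next
    case False
    then have "\<nu> M = (\<Sum>p\<in>#M. 1)" unfolding \<nu>_def
      by (intro arg_cong[of _ _ sum_mset] image_mset_cong) auto
    moreover have "set_mset (image_mset w M) \<subseteq> w ` P - {0}" using False M by (auto simp: atoms_def)
    then have "[size (image_mset w M) = n] (mod d)" using M by (intro len) (auto simp: atoms_def)
    ultimately show ?thesis by simp
  qed
  have sum: "[\<nu> (\<Sum>\<^sub># X) = n * size X] (mod d)" if "set_mset X \<subseteq> atoms" for X
    using that
  proof (induction X)
    case (add M X)
    then have "[\<nu> M + \<nu> (\<Sum>\<^sub># X) = n + n * size X] (mod d)" by (intro cong_add atom) auto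
    then show ?case by (simp add: \<nu>_def)
  qed (simp add: \<nu>_def)
  show ?thesis
    unfolding congruence_half_factorial_iff
  proof (intro allI impI)
    fix X Y assume XY: "set_mset X \<subseteq> atoms" "set_mset Y \<subseteq> atoms" "\<Sum>\<^sub># X = \<Sum>\<^sub># Y"
    have "[n * size X = n * size Y] (mod d)"
      using cong_trans[OF cong_sym[OF sum[OF XY(1)]]] sum[OF XY(2)] by (simp only: XY(3))
    then show "[size X = size Y] (mod d)" by (rule cancel)
  qed
qed

section \<open>The characterization in terms of weights\<close>

theorem congruence_half_factorial_weights:
  assumes p: "Factorial_Ring.prime n" and w: "\<And>p. p \<in> P \<Longrightarrow> w p < n"
    and nhf: "\<not> half_factorial H" and d: "2 * n\<^sup>2 \<le> d ^ 3"
  shows "congruence_half_factorial d H \<longleftrightarrow>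
    (\<exists>g h. w ` P - {0} = {g, h} \<and> (\<exists>c1 c2. 0 < c1 \<and> 0 < c2 \<and> n dvd c2 * g + c1 * h \<and>
      int d * int c1 * int c2 dvd int n - int c1 - int c2))"
    (is "_ \<longleftrightarrow> ?R")
proof -
  define W where "W = w ` P - {0}"
  have W: "0 < g" "g < n" if "g \<in> W" for g using that w by (auto simp: W_def)
  have n2: "n \<ge> 2" using p by (simp add: prime_ge_2_nat)
  have d2: "d \<ge> 2"
  proof (rule ccontr)
    assume "\<not> d \<ge> 2"
    then have "d ^ 3 \<le> 1 ^ 3" by (intro power_mono) auto
    moreover have "2 ^ 2 \<le> n\<^sup>2" using n2 by (intro power_mono) auto
    ultimately show False using d by simp
  qed
  \<comment> \<open>With at most one non-zero class every atom over it has length exactly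
    \<open>n\<close>, a congruence modulo 0, and \<open>H\<close> would be half-factorial.\<close>
  have one_class: "\<not> W \<subseteq> {g}" for g
  proof
    assume sub: "W \<subseteq> {g}"
    have "congruence_half_factorial 0 H"
    proof (rule congruence_half_factorialI)
      show "[s = t] (mod 0)" if "[n * s = n * t] (mod 0)" for s t
        using that n2 by (simp add: cong_def)
      fix B assume B: "set_mset B \<subseteq> w ` P - {0}" "min_zero_sum n B"
      then have "set_mset B \<subseteq> {g}" "B \<noteq> {#}" using sub by (auto simp: W_def min_zero_sum_def)
      then have "g \<in># B" by (auto simp: subset_singleton_iff)
      then have "g \<in> W" using B by (auto simp: W_def)
      then have "size B = n" using min_zero_sum_one_class[OF p] W B \<open>set_mset B \<subseteq> {g}\<close> by blast
      then show "[size B = n] (mod 0)" by simp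
    qed
    then show False using nhf half_factorial_if_congruence_zero by blast
  qed
  show ?thesis
  proof
    assume chf: "congruence_half_factorial d H"
    have rel: "\<exists>c1 c2 m. 0 < c1 \<and> 0 < c2 \<and> 0 < m \<and> n dvd c2 * g + c1 * h \<and> n = c1 + c2 + m * d * c1 * c2"
      if "g \<in> W" "h \<in> W" "g \<noteq> h" for g h
    proof -
      have "[size B = n] (mod d)" if "set_mset B \<subseteq> {g, h}" "min_zero_sum n B" for B
        using that \<open>g \<in> W\<close> \<open>h \<in> W\<close>
        by (intro size_atom_cong[OF p w chf]) (auto simp: W_def)
      then show ?thesis
        using pair_relation[OF p d W[OF that(1)] W[OF that(2)] that(3)] by metis
    qed
    have small: "d * c1 * c2 < n" if "0 < c1" "0 < m" "n = c1 + c2 + m * d * c1 * c2" for c1 c2 m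
    proof -
      have "1 * (d * c1 * c2) \<le> m * (d * c1 * c2)" using that by (intro mult_le_mono) auto
      then have "d * c1 * c2 \<le> m * d * c1 * c2" unfolding mult.assoc mult_1 .
      then show ?thesis using that(1,3) by linarith
    qed
    obtain g h where gh: "g \<in> W" "h \<in> W" "g \<noteq> h" using one_class by blast
    have "k \<in> {g, h}" if k: "k \<in> W" for k
    proof (rule ccontr)
      assume "k \<notin> {g, h}"
      then obtain b1 b2 m1 c1 c2 m2 e1 e2 m3 where
        b: "0 < b1" "0 < b2" "0 < m1" "n dvd b2 * g + b1 * h" "n = b1 + b2 + m1 * d * b1 * b2" and
        c: "0 < c1" "0 < c2" "0 < m2" "n dvd c2 * g + c1 * k" "n = c1 + c2 + m2 * d * c1 * c2" and
        e: "0 < e1" "0 < e2" "0 < m3" "n dvd e2 * h + e1 * k" "n = e1 + e2 + m3 * d * e1 * e2"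
        using rel[OF gh] rel[OF gh(1) k] rel[OF gh(2) k] by blast
      show False
        by (rule no_three_relations[OF p d W[OF gh(2)] b(1,2) c(1,2) e(1,2)
              small[OF b(1,3,5)] small[OF c(1,3,5)] small[OF e(1,3,5)] b(4) c(4) e(4)])
    qed
    then have "W = {g, h}" using gh by blast
    moreover obtain c1 c2 m where c: "0 < c1" "0 < c2" "n dvd c2 * g + c1 * h" "n = c1 + c2 + m * d * c1 * c2"
      using rel[OF gh] by blast
    moreover have "int n = int c1 + int c2 + int m * int d * int c1 * int c2"
      by (subst c(4)) simp
    then have "int n - int c1 - int c2 = (int d * int c1 * int c2) * int m" by simp
    then have "int d * int c1 * int c2 dvd int n - int c1 - int c2" by (rule dvdI)
    ultimately show ?R unfolding W_def by blast
  next
    assume ?R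
    then obtain g h c1 c2 where gh: "W = {g, h}" and c: "0 < c1" "0 < c2" "n dvd c2 * g + c1 * h"
      "int d * int c1 * int c2 dvd int n - int c1 - int c2"
      unfolding W_def by blast
    have ne: "g \<noteq> h" using gh one_class[of g] by auto
    have gW: "0 < g" "g < n" and hW: "0 < h" "h < n" using W gh by auto
    obtain z where z: "int n - int c1 - int c2 = int d * int c1 * int c2 * z" using c(4) by (elim dvdE)
    \<comment> \<open>The divisibility is one of integers, so a zero or negative quotient has to be
      excluded.\<close>
    have "z > 0"
    proof (rule ccontr)
      assume "\<not> z > 0"
      then consider "z = 0" | "z \<le> -1" by linarith
      then show False
      proof cases
        case 1
        then have n: "n = c1 + c2" using z by simp
        \<comment> \<open>With \<open>n = c1 + c2\<close> the relation becomes
          \<open>c2 * (g - h) = 0\<close> modulo \<open>n\<close>, which forces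
          \<open>g = h\<close>.\<close>
        have "int n dvd int c2 * int g + int c1 * int h"
          using c(3) by (metis int_dvd_int_iff of_nat_add of_nat_mult)
        then have "int n dvd int c2 * int g + int c1 * int h - int n * int h" by simp
        also have "\<dots> = int c2 * (int g - int h)" unfolding n by (simp add: algebra_simps)
        finally have dvd: "int n dvd int c2 * (int g - int h)" .
        have "coprime n c2" using p n c(1,2) by (auto intro!: prime_imp_coprime dest!: dvd_imp_le)
        then have "int n dvd int g - int h" using dvd by (simp add: coprime_dvd_mult_right_iff)
        then show False using gW hW ne zdvd_imp_le[of "int n" "int g - int h"] zdvd_imp_le[of "int n" "int h - int g"]
          by (cases "g < h") (auto simp: dvd_diff_commute)
      next
        case 2
        \<comment> \<open>A negative quotient would give \<open>n \<le> c1 + c2 - Q\<close>; but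
          \<open>Q \<ge> 2 * c1 * c2 \<ge> c1 + c2\<close>, so \<open>n\<close> would not be
          positive.\<close>
        define Q where "Q = int d * int c1 * int c2"
        have "Q \<ge> 2 * (int c1 * int c2)"
          unfolding Q_def mult.assoc using d2 by (intro mult_right_mono) auto
        moreover have "(int c1 - 1) * (int c2 - 1) \<ge> 0" using c by simp
        then have "int c1 * int c2 \<ge> int c1 + int c2 - 1" by (simp add: algebra_simps)
        moreover have "int c1 * int c2 > 0" using c by simp
        moreover have "Q * z \<le> Q * (-1)" using 2 calculation by (intro mult_left_mono) auto
        moreover have "int c1 + int c2 \<ge> 2" using c by linarith
        ultimately show False using z n2 unfolding Q_def[symmetric] by linarith
      qed
    qed
    define m where "m = nat z"
    have "int n = int (c1 + c2 + m * d * c1 * c2)" using z \<open>z > 0\<close> by (simp add: m_def algebra_simps)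
    then have n: "n = c1 + c2 + m * d * c1 * c2" by presburger
    \<comment> \<open>Positivity of the quotient gives \<open>d < n\<close>; so \<open>n\<close> is
      prime to \<open>d\<close> and can be cancelled in the criterion.\<close>
    have "d * 1 \<le> d * (m * c1 * c2)"
      using c \<open>z > 0\<close> by (intro mult_le_mono2) (simp add: m_def Suc_leI)
    then have "d \<le> m * d * c1 * c2" by (simp add: ac_simps)
    then have "d < n" using n c by linarith
    then have cop: "coprime n d" using p d2 by (auto intro!: prime_imp_coprime dest!: dvd_imp_le)
    show "congruence_half_factorial d H"
    proof (rule congruence_half_factorialI)
      show "[s = t] (mod d)" if "[n * s = n * t] (mod d)" for s t
        using that cop by (simp add: cong_mult_lcancel_nat coprime_commute)
      fix B assume B: "set_mset B \<subseteq> w ` P - {0}" "min_zero_sum n B"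
      have B2: "set_mset B \<subseteq> {g, h}" using B(1) gh by (simp add: W_def)
      have "B = replicate_mset (count B g) g + replicate_mset (count B h) h"
      proof (rule multiset_eqI)
        fix z show "count B z = count (replicate_mset (count B g) g + replicate_mset (count B h) h) z"
          using ne B2 by (cases "z \<in># B") (auto simp: not_in_iff)
      qed
      then obtain x y where B': "B = replicate_mset x g + replicate_mset y h" by blast
      have "[x + y = n] (mod d)"
        using two_class_minimal[OF p gW hW ne c(1,2) n c(3)] B(2) unfolding B' .
      then show "[size B = n] (mod d)" by (simp add: B')
    qed
  qed
qed

end

section \<open>Weights obtained from the class group\<close>

lemma (in group) finite_cyclic_generator:
  assumes "cyclic_group G" "finite (carrier G)"
  obtains \<gamma> where "\<gamma> \<in> carrier G" "ord \<gamma> = order G"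
    "\<And>x. x \<in> carrier G \<Longrightarrow> \<exists>k < order G. \<gamma> [^] k = x"
proof -
  obtain \<gamma> where g: "\<gamma> \<in> carrier G" "subgroup_generated G {\<gamma>} = G"
    using assms(1) by (auto simp: cyclic_group_def)
  have ord: "ord \<gamma> = order G" using cyclic_order_is_ord[OF g(1)] g(2) by simp
  have "carrier G = generate G {\<gamma>}"
    using g by (metis carrier_subgroup_generated Int_absorb1 empty_subsetI insert_subset)
  then have "carrier G = {\<gamma> [^] k |k. k \<in> (UNIV :: nat set)}"
    using generate_pow_on_finite_carrier[OF assms(2) g(1)] by simp
  then have elems: "carrier G = {\<gamma> [^] k |k. k \<in> {0..ord \<gamma> - 1}}"
    using ord_elems[OF assms(2) g(1)] by simp
  have "order G > 0" using assms(2) by (simp add: order_gt_0_iff_finite)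
  have "\<exists>k < order G. \<gamma> [^] k = x" if x: "x \<in> carrier G" for x
  proof -
    obtain k where "k \<le> ord \<gamma> - 1" "x = \<gamma> [^] k" using elems x by auto
    then show ?thesis using \<open>order G > 0\<close> ord by (intro exI[of _ k]) auto
  qed
  then show thesis using that g ord by blast
qed

lemma divisor_embedding_add: "divisor_embedding (M + N) = divisor_embedding M + divisor_embedding N"
  by (simp add: divisor_embedding_def)

lemma keys_divisor_embedding: "Poly_Mapping.keys (divisor_embedding M) \<subseteq> set_mset M"
proof (induction M)
  case (add p M)
  have "divisor_embedding (add_mset p M) = frag_of p + divisor_embedding M"
    by (simp add: divisor_embedding_def)
  then show ?case using add keys_add[of "frag_of p" "divisor_embedding M"] by auto
qed (simp add: divisor_embedding_def)

lemma inj_divisor_embedding: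
  assumes "divisor_embedding M = divisor_embedding N"
  shows "M = N"
proof (rule multiset_eqI)
  have "Poly_Mapping.lookup (divisor_embedding A) p = int (count A p)" for A :: "'a multiset" and p
    by (induction A) (auto simp: divisor_embedding_def lookup_add)
  then show "count M p = count N p" for p by (metis assms of_nat_eq_iff)
qed

lemma subgroup_principal_divisors:
  assumes H: "comm_monoid_cancel H" and hom: "divisor_homomorphism H P \<phi>"
  shows "subgroup (principal_divisors H \<phi>) (free_Abelian_group P)"
proof -
  interpret comm_monoid_cancel H by (rule H)
  have set_phi: "set_mset (\<phi> a) \<subseteq> P" if "a \<in> carrier H" for a
    using hom that by (auto simp: divisor_homomorphism_def hom_def free_abelian_monoid_def Pi_iff)
  have phi_mult: "\<phi> (a \<otimes>\<^bsub>H\<^esub> b) = \<phi> a + \<phi> b" if "a \<in> carrier H" "b \<in> carrier H" for a b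
    using hom that by (auto simp: divisor_homomorphism_def hom_def free_abelian_monoid_def)
  interpret F: group "free_Abelian_group P" by simp
  have keys: "Poly_Mapping.keys x \<subseteq> P" if "x \<in> principal_divisors H \<phi>" for x
  proof -
    obtain a b where ab: "a \<in> carrier H" "b \<in> carrier H"
      and x: "x = divisor_embedding (\<phi> a) - divisor_embedding (\<phi> b)"
      using \<open>x \<in> _\<close> by (auto simp: principal_divisors_def)
    have "Poly_Mapping.keys x \<subseteq> set_mset (\<phi> a) \<union> set_mset (\<phi> b)"
      unfolding x using keys_diff keys_divisor_embedding by (metis (no_types) Un_mono subset_trans)
    then show ?thesis using set_phi ab by blast
  qed
  show ?thesis
  proof (rule F.subgroupI)
    show "principal_divisors H \<phi> \<subseteq> carrier (free_Abelian_group P)" using keys by auto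
    show "principal_divisors H \<phi> \<noteq> {}" unfolding principal_divisors_def using one_closed by blast
  next
    fix x assume x: "x \<in> principal_divisors H \<phi>"
    then obtain a b where "a \<in> carrier H" "b \<in> carrier H"
      "x = divisor_embedding (\<phi> a) - divisor_embedding (\<phi> b)"
      by (auto simp: principal_divisors_def)
    then have "- x \<in> principal_divisors H \<phi>" unfolding principal_divisors_def
      by (intro CollectI exI[of _ b] exI[of _ a]) simp
    then show "inv\<^bsub>free_Abelian_group P\<^esub> x \<in> principal_divisors H \<phi>" using keys[OF x] by simp
  next
    fix x y assume "x \<in> principal_divisors H \<phi>" "y \<in> principal_divisors H \<phi>"
    then obtain a b a' b' where "a \<in> carrier H" "b \<in> carrier H" "a' \<in> carrier H" "b' \<in> carrier H"
      "x = divisor_embedding (\<phi> a) - divisor_embedding (\<phi> b)"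
      "y = divisor_embedding (\<phi> a') - divisor_embedding (\<phi> b')"
      unfolding principal_divisors_def by blast
    then have "x + y \<in> principal_divisors H \<phi>" unfolding principal_divisors_def
      by (intro CollectI exI[of _ "a \<otimes>\<^bsub>H\<^esub> a'"] exI[of _ "b \<otimes>\<^bsub>H\<^esub> b'"])
        (simp add: phi_mult divisor_embedding_add)
    then show "x \<otimes>\<^bsub>free_Abelian_group P\<^esub> y \<in> principal_divisors H \<phi>" by simp
  qed
qed

text \<open>If \<open>\<phi> a = \<phi> b + M\<close>, then \<open>b\<close> divides
  \<open>a\<close> because \<phi> reflects divisibility, and \<open>M\<close> is the image of the
  quotient. So an effective divisor in the trivial class comes from an element of \<open>H\<close>,
  not merely from a fraction.\<close>

lemma divisor_embedding_principal_iff: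
  assumes H: "comm_monoid_cancel H" and hom: "divisor_homomorphism H P \<phi>" and M: "set_mset M \<subseteq> P"
  shows "divisor_embedding M \<in> principal_divisors H \<phi> \<longleftrightarrow> M \<in> \<phi> ` carrier H"
proof
  interpret comm_monoid_cancel H by (rule H)
  have phi_mult: "\<phi> (a \<otimes>\<^bsub>H\<^esub> b) = \<phi> a + \<phi> b" if "a \<in> carrier H" "b \<in> carrier H" for a b
    using hom that by (auto simp: divisor_homomorphism_def hom_def free_abelian_monoid_def)
  {
    assume "divisor_embedding M \<in> principal_divisors H \<phi>"
    then obtain a b where ab: "a \<in> carrier H" "b \<in> carrier H"
      and "divisor_embedding M = divisor_embedding (\<phi> a) - divisor_embedding (\<phi> b)"
      by (auto simp: principal_divisors_def)
    then have "divisor_embedding (\<phi> b + M) = divisor_embedding (\<phi> a)"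
      by (simp add: divisor_embedding_add)
    then have eq: "\<phi> a = \<phi> b + M" by (metis inj_divisor_embedding)
    then have "\<phi> b divides\<^bsub>free_abelian_monoid P\<^esub> \<phi> a"
      using M by (auto simp: factor_def free_abelian_monoid_def)
    then have "b divides\<^bsub>H\<^esub> a" using hom ab by (simp add: divisor_homomorphism_def)
    then obtain c where "c \<in> carrier H" "a = b \<otimes>\<^bsub>H\<^esub> c" by (auto simp: factor_def)
    then show "M \<in> \<phi> ` carrier H" using eq phi_mult[of b c] ab by auto
  next
    assume "M \<in> \<phi> ` carrier H"
    then obtain a where a: "a \<in> carrier H" "M = \<phi> a" by blast
    have "\<phi> \<one>\<^bsub>H\<^esub> = {#}" using phi_mult[of "\<one>\<^bsub>H\<^esub>" "\<one>\<^bsub>H\<^esub>"] by simp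
    then have "divisor_embedding M = divisor_embedding (\<phi> a) - divisor_embedding (\<phi> \<one>\<^bsub>H\<^esub>)"
      using a by (simp add: divisor_embedding_def)
    then show "divisor_embedding M \<in> principal_divisors H \<phi>"
      unfolding principal_divisors_def using a by blast
  }
qed

text \<open>Discrete logarithms with respect to a generator \<gamma> serve as weights: the class of
  a divisor is \<gamma> raised to its weight sum, hence trivial exactly when the group order divides
  this sum.\<close>

lemma class_group_weights:
  fixes H :: "('a, 'm) monoid_scheme" and P :: "'p set" and \<phi> :: "'a \<Rightarrow> 'p multiset"
  defines "G \<equiv> class_group H P \<phi>"
  assumes H: "comm_monoid_cancel H" and hom: "divisor_homomorphism H P \<phi>"
    and fin: "finite (carrier G)" and cyc: "cyclic_group G"
  obtains \<gamma> w where "comm_group G" "\<gamma> \<in> carrier G" "group.ord G \<gamma> = order G"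
    "\<And>p. p \<in> P \<Longrightarrow> w p < order G" "divisor_weights H P \<phi> (order G) w"
    "nonzero_prime_classes H P \<phi> = (\<lambda>k. \<gamma> [^]\<^bsub>G\<^esub> k) ` (w ` P - {0})"
proof -
  define F where "F = free_Abelian_group P"
  define N where "N = principal_divisors H \<phi>"
  interpret F: comm_group F unfolding F_def by (rule abelian_free_Abelian_group)
  have sub: "subgroup N F" unfolding N_def F_def by (rule subgroup_principal_divisors[OF H hom])
  interpret N: normal N F by (rule F.subgroup_imp_normal[OF sub])
  have G: "G = F Mod N" by (simp add: G_def class_group_def F_def N_def)
  interpret G: group G unfolding G by (rule N.factorgroup_is_group)
  have comm: "comm_group G" using G.cyclic_imp_abelian_group[OF cyc] .
  define cl where "cl x = N #>\<^bsub>F\<^esub> x" for x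
  have one: "\<one>\<^bsub>G\<^esub> = N" by (simp add: G)
  have cl_closed: "cl x \<in> carrier G" if "x \<in> carrier F" for x
    using that by (simp add: cl_def G carrier_FactGroup)
  have cl_add: "cl (x + y) = cl x \<otimes>\<^bsub>G\<^esub> cl y" if "x \<in> carrier F" "y \<in> carrier F" for x y
    using hom_mult[OF N.r_coset_hom_Mod that] by (simp add: cl_def G F_def)
  have cl_one: "cl x = \<one>\<^bsub>G\<^esub> \<longleftrightarrow> x \<in> N" if "x \<in> carrier F" for x
    unfolding cl_def one using that sub F.coset_join1 F.coset_join2 by blast
  have frag: "frag_of p \<in> carrier F" if "p \<in> P" for p
    using that by (simp add: F_def)
  obtain \<gamma> where g: "\<gamma> \<in> carrier G" "G.ord \<gamma> = order G"
    and gen: "\<And>x. x \<in> carrier G \<Longrightarrow> \<exists>k < order G. \<gamma> [^]\<^bsub>G\<^esub> k = x"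
    using G.finite_cyclic_generator[OF cyc fin] by blast
  \<comment> \<open>The exponent is taken below the group order, so that it is 0 exactly for
    principal prime divisors.\<close>
  define w where "w p = (SOME k. k < order G \<and> \<gamma> [^]\<^bsub>G\<^esub> k = cl (frag_of p))" for p
  have w: "w p < order G" "\<gamma> [^]\<^bsub>G\<^esub> w p = cl (frag_of p)" if "p \<in> P" for p
    using someI_ex[of "\<lambda>k. k < order G \<and> \<gamma> [^]\<^bsub>G\<^esub> k = cl (frag_of p)"]
      gen[OF cl_closed[OF frag[OF that]]] unfolding w_def by auto
  have embF: "divisor_embedding M \<in> carrier F" if "set_mset M \<subseteq> P" for M
    using that keys_divisor_embedding[of M] by (auto simp: F_def)
  have clM: "cl (divisor_embedding M) = \<gamma> [^]\<^bsub>G\<^esub> (\<Sum>p\<in>#M. w p)" if "set_mset M \<subseteq> P" for M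
    using that
  proof (induction M)
    case empty
    then show ?case using cl_one[of 0] N.one_closed by (simp add: divisor_embedding_def F_def)
  next
    case (add p M)
    have "divisor_embedding (add_mset p M) = frag_of p + divisor_embedding M"
      by (simp add: divisor_embedding_def)
    then show ?case using add g(1) frag embF by (simp add: cl_add w(2)[symmetric] G.nat_pow_mult)
  qed
  have dw: "divisor_weights H P \<phi> (order G) w"
  proof (intro divisor_weights.intro divisor_weights_axioms.intro H hom)
    fix M assume M: "set_mset M \<subseteq> P"
    have "M \<in> \<phi> ` carrier H \<longleftrightarrow> cl (divisor_embedding M) = \<one>\<^bsub>G\<^esub>"
      using cl_one[OF embF[OF M]] divisor_embedding_principal_iff[OF H hom M] by (simp add: N_def)
    also have "\<dots> \<longleftrightarrow> order G dvd (\<Sum>p\<in>#M. w p)"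
      using G.pow_eq_id[OF g(1)] by (simp add: clM[OF M] g(2))
    finally show "M \<in> \<phi> ` carrier H \<longleftrightarrow> order G dvd (\<Sum>p\<in>#M. w p)" .
  qed
  \<comment> \<open>Cosets are disjoint, so the only class containing \<open>p\<close> is the coset
    of \<open>p\<close>.\<close>
  have mem: "frag_of p \<in> x \<longleftrightarrow> x = cl (frag_of p)" if p: "p \<in> P" and x: "x \<in> carrier G" for p x
  proof -
    obtain y where y: "y \<in> carrier F" "x = N #>\<^bsub>F\<^esub> y" using x by (auto simp: G carrier_FactGroup)
    show ?thesis
    proof
      assume "frag_of p \<in> x"
      then show "x = cl (frag_of p)"
        unfolding cl_def y(2) by (rule F.repr_independence[OF _ y(1) sub])
    next
      assume "x = cl (frag_of p)"
      then show "frag_of p \<in> x" using F.rcos_self[OF frag[OF p] sub] by (simp only: cl_def)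
    qed
  qed
  have w0: "cl (frag_of p) = \<one>\<^bsub>G\<^esub> \<longleftrightarrow> w p = 0" if p: "p \<in> P" for p
  proof -
    have "cl (frag_of p) = \<one>\<^bsub>G\<^esub> \<longleftrightarrow> order G dvd w p"
      using G.pow_eq_id[OF g(1), of "w p"] by (simp only: w(2)[OF p] g(2))
    also have "\<dots> \<longleftrightarrow> w p = 0" using w(1)[OF p] by (auto dest: dvd_imp_le)
    finally show ?thesis .
  qed
  have classes: "nonzero_prime_classes H P \<phi> = (\<lambda>k. \<gamma> [^]\<^bsub>G\<^esub> k) ` (w ` P - {0})"
  proof (intro equalityI subsetI)
    fix x assume "x \<in> nonzero_prime_classes H P \<phi>"
    then obtain p where "p \<in> P" "x = cl (frag_of p)" "x \<noteq> \<one>\<^bsub>G\<^esub>"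
      using mem unfolding nonzero_prime_classes_def G_def[symmetric] by auto
    then show "x \<in> (\<lambda>k. \<gamma> [^]\<^bsub>G\<^esub> k) ` (w ` P - {0})" using w w0 by (intro image_eqI[of _ _ "w p"]) auto
  next
    fix x assume "x \<in> (\<lambda>k. \<gamma> [^]\<^bsub>G\<^esub> k) ` (w ` P - {0})"
    then obtain p where p: "p \<in> P" "w p \<noteq> 0" "x = cl (frag_of p)" using w by auto
    then show "x \<in> nonzero_prime_classes H P \<phi>"
      using mem[of p x] w0 cl_closed[OF frag] unfolding nonzero_prime_classes_def G_def[symmetric] by auto
  qed
  show thesis by (rule that[of \<gamma> w, OF comm g w(1) dw classes])
qed

section \<open>Return from weights to classes\<close>

theorem theorem2p2:
  fixes H :: "('a, 'm) monoid_scheme"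
    and P :: "'p set"
    and \<phi> :: "'a \<Rightarrow> 'p multiset"
    and d :: nat
  defines "G \<equiv> class_group H P \<phi>"
  assumes "krull_monoid H"
    and "divisor_theory H P \<phi>"
    and "\<not> half_factorial H"
    and "finite (carrier G)"
    and "cyclic_group G"
    and "Factorial_Ring.prime (order G)"
    and "real d \<ge> (2 * real (order G) ^ 2) powr (1 / 3)"
  shows "congruence_half_factorial d H \<longleftrightarrow>
    card (nonzero_prime_classes H P \<phi>) \<le> 2 \<and>
    (\<exists>g1 g2. nonzero_prime_classes H P \<phi> = {g1, g2} \<and>
      (\<exists>c1 c2 :: nat. c1 > 0 \<and> c2 > 0 \<and>
        g1 [^]\<^bsub>G\<^esub> c2 \<otimes>\<^bsub>G\<^esub> g2 [^]\<^bsub>G\<^esub> c1 = \<one>\<^bsub>G\<^esub> \<and>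
        int d * int c1 * int c2 dvd int (order G) - int c1 - int c2))"
proof -
  define n where "n = order G"
  have H: "comm_monoid_cancel H" using assms(2) by (simp add: krull_monoid_def)
  have hom: "divisor_homomorphism H P \<phi>" using assms(3) by (simp add: divisor_theory_def)
  \<comment> \<open>Cubing the real bound removes the root and leaves an inequality of natural
    numbers.\<close>
  have d: "2 * n\<^sup>2 \<le> d ^ 3"
  proof -
    have "((2 * real n ^ 2) powr (1 / 3)) ^ 3 \<le> real d ^ 3"
      using assms(8) by (intro power_mono) (auto simp: n_def)
    moreover have "((2 * real n ^ 2) powr (1 / 3)) ^ 3 = 2 * real n ^ 2"
      by (cases "n = 0") (simp_all add: powr_power)
    ultimately have "real (2 * n\<^sup>2) \<le> real (d ^ 3)" by simp
    then show ?thesis by (simp only: of_nat_le_iff)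
  qed
  obtain \<gamma> w where G: "comm_group G" and g: "\<gamma> \<in> carrier G" "group.ord G \<gamma> = n"
    and w: "\<And>p. p \<in> P \<Longrightarrow> w p < n" and dw: "divisor_weights H P \<phi> n w"
    and classes: "nonzero_prime_classes H P \<phi> = (\<lambda>k. \<gamma> [^]\<^bsub>G\<^esub> k) ` (w ` P - {0})"
    using class_group_weights[OF H hom] assms(5,6) unfolding n_def G_def by metis
  interpret G: comm_group G by (rule G)
  define W where "W = w ` P - {0}"
  \<comment> \<open>All weights lie below the order of \<gamma>, so distinct weights give distinct
    classes.\<close>
  have inj: "inj_on (\<lambda>k. \<gamma> [^]\<^bsub>G\<^esub> k) W"
    by (rule inj_on_subset[OF G.ord_inj[OF g(1)]]) (use w g(2) in \<open>fastforce simp: W_def\<close>)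
  have rel: "(\<gamma> [^]\<^bsub>G\<^esub> g) [^]\<^bsub>G\<^esub> c2 \<otimes>\<^bsub>G\<^esub> (\<gamma> [^]\<^bsub>G\<^esub> h) [^]\<^bsub>G\<^esub> c1 = \<one>\<^bsub>G\<^esub> \<longleftrightarrow>
      n dvd c2 * g + c1 * h" for g h c1 c2 :: nat
    using G.pow_eq_id[OF \<open>\<gamma> \<in> carrier G\<close>, of "c2 * g + c1 * h"] \<open>\<gamma> \<in> carrier G\<close> \<open>G.ord \<gamma> = n\<close>
    by (simp add: G.nat_pow_pow G.nat_pow_mult mult.commute)
  have chf: "congruence_half_factorial d H \<longleftrightarrow>
    (\<exists>g h. W = {g, h} \<and> (\<exists>c1 c2. 0 < c1 \<and> 0 < c2 \<and> n dvd c2 * g + c1 * h \<and>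
      int d * int c1 * int c2 dvd int n - int c1 - int c2))"
    unfolding W_def
    by (rule divisor_weights.congruence_half_factorial_weights[OF dw _ w assms(4) d])
      (use assms(7) in \<open>simp_all add: n_def\<close>)
  show ?thesis
    unfolding classes W_def[symmetric] n_def[symmetric] chf
  proof
    assume "\<exists>g h. W = {g, h} \<and> (\<exists>c1 c2. 0 < c1 \<and> 0 < c2 \<and> n dvd c2 * g + c1 * h \<and>
      int d * int c1 * int c2 dvd int n - int c1 - int c2)"
    then obtain g h c1 c2 where gh: "W = {g, h}" and c: "0 < c1" "0 < c2" "n dvd c2 * g + c1 * h"
      "int d * int c1 * int c2 dvd int n - int c1 - int c2" by blast
    have card: "card ((\<lambda>k. \<gamma> [^]\<^bsub>G\<^esub> k) ` W) \<le> 2" by (simp add: gh card_insert_if)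
    have im: "(\<lambda>k. \<gamma> [^]\<^bsub>G\<^esub> k) ` W = {\<gamma> [^]\<^bsub>G\<^esub> g, \<gamma> [^]\<^bsub>G\<^esub> h}" by (simp add: gh)
    have ex: "\<exists>c1 c2 :: nat. c1 > 0 \<and> c2 > 0 \<and>
        (\<gamma> [^]\<^bsub>G\<^esub> g) [^]\<^bsub>G\<^esub> c2 \<otimes>\<^bsub>G\<^esub> (\<gamma> [^]\<^bsub>G\<^esub> h) [^]\<^bsub>G\<^esub> c1 = \<one>\<^bsub>G\<^esub> \<and>
        int d * int c1 * int c2 dvd int n - int c1 - int c2"
      by (rule exI[of _ c1], rule exI[of _ c2]) (use c rel[of g c2 h c1] in simp)
    show "card ((\<lambda>k. \<gamma> [^]\<^bsub>G\<^esub> k) ` W) \<le> 2 \<and>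
      (\<exists>g1 g2. (\<lambda>k. \<gamma> [^]\<^bsub>G\<^esub> k) ` W = {g1, g2} \<and>
        (\<exists>c1 c2 :: nat. c1 > 0 \<and> c2 > 0 \<and>
          g1 [^]\<^bsub>G\<^esub> c2 \<otimes>\<^bsub>G\<^esub> g2 [^]\<^bsub>G\<^esub> c1 = \<one>\<^bsub>G\<^esub> \<and>
          int d * int c1 * int c2 dvd int n - int c1 - int c2))"
      by (rule conjI[OF card], rule exI, rule exI, rule conjI[OF im ex])
  next
    assume "card ((\<lambda>k. \<gamma> [^]\<^bsub>G\<^esub> k) ` W) \<le> 2 \<and>
      (\<exists>g1 g2. (\<lambda>k. \<gamma> [^]\<^bsub>G\<^esub> k) ` W = {g1, g2} \<and>
        (\<exists>c1 c2 :: nat. c1 > 0 \<and> c2 > 0 \<and>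
          g1 [^]\<^bsub>G\<^esub> c2 \<otimes>\<^bsub>G\<^esub> g2 [^]\<^bsub>G\<^esub> c1 = \<one>\<^bsub>G\<^esub> \<and>
          int d * int c1 * int c2 dvd int n - int c1 - int c2))"
    then obtain g1 g2 c1 c2 where im: "(\<lambda>k. \<gamma> [^]\<^bsub>G\<^esub> k) ` W = {g1, g2}"
      and c: "0 < c1" "0 < c2" "g1 [^]\<^bsub>G\<^esub> c2 \<otimes>\<^bsub>G\<^esub> g2 [^]\<^bsub>G\<^esub> c1 = \<one>\<^bsub>G\<^esub>"
        "int d * int c1 * int c2 dvd int n - int c1 - int c2"
      by (elim exE conjE) (rule that)
    \<comment> \<open>The classes \<open>g1\<close> and \<open>g2\<close> are powers of \<gamma>
      with exponents in \<open>W\<close>; injectivity turns the equality of images into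
      \<open>W = {g, h}\<close>.\<close>
    have "g1 \<in> (\<lambda>k. \<gamma> [^]\<^bsub>G\<^esub> k) ` W" "g2 \<in> (\<lambda>k. \<gamma> [^]\<^bsub>G\<^esub> k) ` W" by (simp_all add: im)
    then obtain g h where gh: "g \<in> W" "h \<in> W" "g1 = \<gamma> [^]\<^bsub>G\<^esub> g" "g2 = \<gamma> [^]\<^bsub>G\<^esub> h"
      by (elim imageE)
    then have "(\<lambda>k. \<gamma> [^]\<^bsub>G\<^esub> k) ` W = (\<lambda>k. \<gamma> [^]\<^bsub>G\<^esub> k) ` {g, h}" using im by simp
    then have "W = {g, h}" using inj gh by (subst (asm) inj_on_image_eq_iff[of _ W]) auto
    moreover have "n dvd c2 * g + c1 * h" using c(3) gh rel by simp
    ultimately show "\<exists>g h. W = {g, h} \<and> (\<exists>c1 c2. 0 < c1 \<and> 0 < c2 \<and> n dvd c2 * g + c1 * h \<and>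
      int d * int c1 * int c2 dvd int n - int c1 - int c2)" using c by blast
  qed
qed

end
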